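(* (i) Let $S\equiv\pm\{1, 8, 10, 11, 12, 13, 14, 15, 17, 19, 21, 23\}\pmod{60}$ and $T\equiv\pm\{1, 7, 9, 10, 11, 12, 13, 15, 23, 26, 28, 29\}\pmod{60}$. Then $p(S,n)=p(T,n-1)$ for all $n\geq 1$. (ii) Let $S\equiv\pm\{2, 3, 7, 10, 11, 15, 16, 17, 19, 23, 24, 29\}\pmod{60}$ and $T\equiv\pm\{1, 4, 7, 10, 13, 15, 17, 19, 22, 24, 27, 29\}\pmod{60}$. Then $p(S,n)=p(T,n-2)$ for all $n\geq 2$. (iii) Let $S\equiv\pm\{1, 3, 4, 10, 11, 13, 15, 17, 22, 23, 24, 29\}\pmod{60}$ and $T\equiv\pm\{1, 2, 7, 10, 11, 13, 15, 16, 19, 23, 24, 27\}\pmod{60}$. Then $p(S,n)=p(T,n)$ for all integers $n\ge0$ with $n\neq 2$. (iv) Let $S\equiv\pm\{7, 8, 9, 10, 11, 12, 13, 14, 15, 17, 19, 29\}\pmod{60}$ and $T\equiv\pm\{1, 7, 10, 12, 15, 17, 19, 21, 23, 26, 28, 29\}\pmod{60}$. Then $p(S,n)=p(T,n-7)$ for all $n\geq 7$.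
   Context: For a set $S$ of positive integers and an integer $n\ge 0$, $p(S,n)$ denotes the number of partitions of $n$ into parts belonging to $S$ (so $p(S,0)=1$). The notation $S\equiv\pm\{r_1,\dots,r_k\}\pmod M$ means that $S$ is the set of all positive integers $n$ such that $n\equiv r_i$ or $n\equiv -r_i\pmod M$ for some $i$. *)

theory Defs
  imports "HOL-Library.Multiset" "HOL-Number_Theory.Cong"
begin

text \<open>
  A partition of \<open>n\<close> into parts from \<open>S\<close> is a finite multiset of elements of \<open>S\<close> with sum \<open>n\<close>.
  The set below is finite if \<open>0 \<notin> S\<close>, so that \<^const>\<open>card\<close> has its intended meaning;
  the sets given by \<open>pm_residues\<close> consist of positive integers only.
\<close>

definition partition_count :: "nat set \<Rightarrow> nat \<Rightarrow> nat" where
  "partition_count S n = card {P :: nat multiset. set_mset P \<subseteq> S \<and> sum_mset P = n}"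

definition pm_residues :: "int set \<Rightarrow> int \<Rightarrow> nat set" where
  "pm_residues R M = {n. 0 < n \<and> (\<exists>r\<in>R. [int n = r] (mod M) \<or> [int n = - r] (mod M))}"

end

theory Submission
  imports Defs "HOL-Complex_Analysis.Cauchy_Integral_Formula"
begin

text \<open>
  Write \<open>[k]\<close> for the generalized Dedekind eta function of level 60, that is
  \<open>(q\<^sup>k; q\<^sup>6\<^sup>0)\<^sub>\<infinity> (q\<^bsup>60-k\<^esup>; q\<^sup>6\<^sup>0)\<^sub>\<infinity>\<close> times the power of \<open>q\<close> that makes \<open>[k]\<close> an odd function of \<open>k\<close>. Up to
  that power, the partitions into parts congruent to \<open>\<plusminus>r\<close> modulo 60, \<open>r \<in> R\<close>, are generated by the
  inverse of the product of the \<open>[r]\<close>, and each part of the theorem says that two such inverses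
  differ by 1. For part (i), the Weierstrass addition formula gives
  \<open>[9] Z = [26,28] [1,23] + [8,14] [17,19]\<close> and \<open>[21] Z = [26,28] [7,29] + [8,14] [11,13]\<close>, where
  \<open>Z = [15,18,20]\<close>. Eliminating the mixed terms leaves \<open>[26,28]\<^sup>2 [1,7,23,29] - [8,14]\<^sup>2 [11,13,17,19]\<close>,
  and this is a product by a Weierstrass relation of modulus 30 with two negative arguments. The other
  elimination from the same two relations is part (iv), and multiplying all residues by 7 turns
  parts (i) and (iv) into parts (ii) and (iii).
\<close>

subsection \<open>Infinite q-products\<close>

definition qpoch :: "nat \<Rightarrow> 'a \<Rightarrow> 'a \<Rightarrow> 'a :: comm_ring_1" where
  "qpoch n z Q = (\<Prod>i<n. 1 - z * Q ^ i)"

definition qpoch_inf :: "'a \<Rightarrow> 'a \<Rightarrow> 'a :: {real_normed_field, banach}" where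
  "qpoch_inf z Q = (\<Prod>i. 1 - z * Q ^ i)"

lemma qpoch_0 [simp]: "qpoch 0 z Q = 1"
  by (simp add: qpoch_def)

lemma qpoch_Suc: "qpoch (Suc n) z Q = qpoch n z Q * (1 - z * Q ^ n)"
  by (simp add: qpoch_def)

lemma qpoch_Suc_shift: "qpoch (Suc n) z Q = (1 - z) * qpoch n (z * Q) Q"
  unfolding qpoch_def prod.lessThan_Suc_shift by (simp add: mult_ac)

lemma convergent_prod_qpoch:
  fixes z Q :: "'a :: {real_normed_field, banach}"
  assumes "norm Q < 1"
  shows "convergent_prod (\<lambda>i. 1 - z * Q ^ i)"
proof -
  have "summable (\<lambda>i. norm ((1 - z * Q ^ i) - 1))"
    using assms by (simp add: norm_mult norm_power summable_mult)
  then show ?thesis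
    by (intro abs_convergent_prod_imp_convergent_prod summable_imp_abs_convergent_prod)
qed

lemma qpoch_tendsto: "norm Q < 1 \<Longrightarrow> (\<lambda>n. qpoch n z Q) \<longlonglongrightarrow> qpoch_inf z Q"
  using convergent_prod_LIMSEQ[OF convergent_prod_qpoch[of Q z]]
  unfolding qpoch_def qpoch_inf_def by (simp add: LIMSEQ_lessThan_iff_atMost)

lemma qpoch_inf_nonzero: "norm Q < 1 \<Longrightarrow> (\<And>i. z * Q ^ i \<noteq> 1) \<Longrightarrow> qpoch_inf z Q \<noteq> 0"
  unfolding qpoch_inf_def by (rule prodinf_nonzero[OF convergent_prod_qpoch]) auto

lemma qpoch_inf_shift:
  assumes "norm Q < 1"
  shows "qpoch_inf z Q = (1 - z) * qpoch_inf (z * Q) Q"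
proof (rule LIMSEQ_unique)
  show "(\<lambda>n. qpoch (Suc n) z Q) \<longlonglongrightarrow> qpoch_inf z Q"
    using qpoch_tendsto[OF assms] by (rule LIMSEQ_Suc)
  show "(\<lambda>n. qpoch (Suc n) z Q) \<longlonglongrightarrow> (1 - z) * qpoch_inf (z * Q) Q"
    unfolding qpoch_Suc_shift by (intro tendsto_intros qpoch_tendsto assms)
qed

lemma qpoch_inf_bisect:
  assumes "norm Q < 1"
  shows "qpoch_inf z Q = qpoch_inf z (Q\<^sup>2) * qpoch_inf (z * Q) (Q\<^sup>2)"
proof (rule LIMSEQ_unique)
  have "qpoch (2 * n) z Q = qpoch n z (Q\<^sup>2) * qpoch n (z * Q) (Q\<^sup>2)" for n
    by (induction n) (simp_all flip: power_mult add: qpoch_Suc mult_ac)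
  moreover have "norm (Q\<^sup>2) < 1"
    using assms by (simp add: norm_power power_less_one_iff)
  ultimately show "(\<lambda>n. qpoch (2 * n) z Q) \<longlonglongrightarrow> qpoch_inf z (Q\<^sup>2) * qpoch_inf (z * Q) (Q\<^sup>2)"
    by (simp add: tendsto_mult qpoch_tendsto)
  show "(\<lambda>n. qpoch (2 * n) z Q) \<longlonglongrightarrow> qpoch_inf z Q"
    using LIMSEQ_subseq_LIMSEQ[OF qpoch_tendsto[OF assms, of z], of "\<lambda>n. 2 * n"]
    by (simp add: o_def strict_mono_def)
qed

lemma qpoch_inf_mult_minus:
  assumes "norm Q < 1"
  shows "qpoch_inf z Q * qpoch_inf (- z) Q = qpoch_inf (z\<^sup>2) (Q\<^sup>2)"
proof -
  have "(1 - z * Q ^ i) * (1 - - z * Q ^ i) = 1 - z\<^sup>2 * (Q\<^sup>2) ^ i" for i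
    unfolding power2_eq_square power_mult_distrib by algebra
  then show ?thesis
    using prodinf_mult[OF convergent_prod_qpoch[OF assms, of z] convergent_prod_qpoch[OF assms, of "- z"]]
    by (simp add: qpoch_inf_def)
qed

definition mod_theta :: "'a \<Rightarrow> 'a \<Rightarrow> 'a :: {real_normed_field, banach}" where
  "mod_theta z Q = qpoch_inf z Q * qpoch_inf (Q / z) Q"

lemma mod_theta_reflect: "z \<noteq> 0 \<Longrightarrow> Q \<noteq> 0 \<Longrightarrow> mod_theta (Q / z) Q = mod_theta z Q"
  by (simp add: mod_theta_def)

lemma mod_theta_inverse:
  assumes "norm Q < 1" "z \<noteq> 0"
  shows "mod_theta (inverse z) Q = - (mod_theta z Q / z)"
proof -
  have "mod_theta (inverse z) Q = (1 - inverse z) * (qpoch_inf (z * Q) Q * qpoch_inf (Q / z) Q)"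
    using qpoch_inf_shift[OF assms(1), of "inverse z"] by (simp add: mod_theta_def divide_inverse mult_ac)
  also have "1 - inverse z = - ((1 - z) / z)"
    using assms(2) by (simp add: field_simps)
  also have "- ((1 - z) / z) * (qpoch_inf (z * Q) Q * qpoch_inf (Q / z) Q) = - (mod_theta z Q / z)"
    using qpoch_inf_shift[OF assms(1), of z] by (simp add: mod_theta_def)
  finally show ?thesis .
qed

lemma mod_theta_nonzero:
  assumes "norm Q < 1" "\<And>i. z * Q ^ i \<noteq> 1" "\<And>i. Q / z * Q ^ i \<noteq> 1"
  shows "mod_theta z Q \<noteq> 0"
  unfolding mod_theta_def using assms by (simp add: qpoch_inf_nonzero)

lemma mod_theta_bisect:
  assumes "norm Q < 1" "Q \<noteq> 0" "z \<noteq> 0"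
  shows "mod_theta z Q = mod_theta z (Q\<^sup>2) * mod_theta (Q / z) (Q\<^sup>2)"
  using assms
  by (simp add: mod_theta_def qpoch_inf_bisect[of Q z] qpoch_inf_bisect[of Q "Q / z"]
      power2_eq_square mult.commute)

lemma mod_theta_mult_minus:
  assumes "norm Q < 1"
  shows "mod_theta z Q * mod_theta (- z) Q = mod_theta (z\<^sup>2) (Q\<^sup>2)"
  using qpoch_inf_mult_minus[OF assms, of z] qpoch_inf_mult_minus[OF assms, of "Q / z"]
  by (simp add: mod_theta_def power_divide mult_ac)

subsection \<open>Gaussian binomial coefficients\<close>

lemma power_neq_1:
  fixes q :: "'a :: real_normed_div_algebra"
  assumes "norm q < 1" "n > 0"
  shows "q ^ n \<noteq> 1"
  using assms by (metis norm_one norm_power order_less_irrefl norm_ge_zero power_less_one_iff)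

lemma qpoch_self_nonzero:
  fixes Q :: "'a :: real_normed_field"
  assumes "norm Q < 1"
  shows "qpoch n Q Q \<noteq> 0"
  unfolding qpoch_def using power_neq_1[OF assms] by (auto simp flip: power_Suc)

lemma qpoch_inf_self_nonzero: "norm Q < 1 \<Longrightarrow> qpoch_inf Q Q \<noteq> 0"
  using power_neq_1[of Q] by (intro qpoch_inf_nonzero) (auto simp flip: power_Suc)

text \<open>
  Reading \<open>1 / (Q; Q)\<^sub>j\<close> as zero for \<open>j < 0\<close> makes the \<open>q\<close>-Pascal rules hold without
  side conditions on \<open>j\<close>.
\<close>

definition inv_qfact :: "'a \<Rightarrow> int \<Rightarrow> 'a :: field" where
  "inv_qfact Q j = (if j < 0 then 0 else inverse (qpoch (nat j) Q Q))"

lemma inv_qfact_diff_1: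
  fixes Q :: "'a :: real_normed_field"
  assumes "norm Q < 1"
  shows "inv_qfact Q (j - 1) = (1 - Q powi j) * inv_qfact Q j"
proof (cases "j \<le> 0")
  case True
  then show ?thesis
    by (cases "j = 0") (auto simp: inv_qfact_def)
next
  case False
  then obtain n where n: "j = int (Suc n)"
    using that[of "nat (j - 1)"] by simp
  have "qpoch (Suc n) Q Q = qpoch n Q Q * (1 - Q powi j)"
    unfolding n power_int_of_nat by (simp add: qpoch_Suc)
  moreover have "1 - Q powi j \<noteq> 0"
    unfolding n power_int_of_nat using power_neq_1[OF assms, of "Suc n"] by simp
  moreover have "nat j = Suc n" "nat (j - 1) = n"
    using n by simp_all
  ultimately show ?thesis
    using False by (simp add: inv_qfact_def)
qed

definition qbinom :: "'a \<Rightarrow> nat \<Rightarrow> int \<Rightarrow> 'a :: field" where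
  "qbinom Q n j = qpoch n Q Q * inv_qfact Q j * inv_qfact Q (int n - j)"

lemma qbinom_0: "qbinom Q 0 j = (if j = 0 then 1 else 0)"
  by (simp add: qbinom_def inv_qfact_def)

lemma
  fixes Q :: "'a :: real_normed_field"
  assumes Q: "norm Q < 1" "Q \<noteq> 0"
  shows qbinom_Suc_left: "qbinom Q (Suc n) j = qbinom Q n (j - 1) + Q powi j * qbinom Q n j"
    and qbinom_Suc_right: "qbinom Q (Suc n) j = qbinom Q n j + Q powi (int n + 1 - j) * qbinom Q n (j - 1)"
proof -
  define a b R S where "a = Q powi j" and "b = Q powi (int n + 1 - j)"
    and "R = inv_qfact Q j" and "S = inv_qfact Q (int n + 1 - j)"
  have "a * b = Q powi (j + (int n + 1 - j))"
    unfolding a_def b_def using Q by (intro power_int_add[symmetric]) simp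
  also have "\<dots> = Q ^ Suc n"
    using power_int_of_nat[of Q "Suc n"] by (simp add: add.commute)
  finally have "qpoch (Suc n) Q Q = qpoch n Q Q * (1 - a * b)"
    by (simp add: qpoch_Suc)
  moreover have "inv_qfact Q (j - 1) = (1 - a) * R" "inv_qfact Q (int n - j) = (1 - b) * S"
    using inv_qfact_diff_1[OF Q(1), of j] inv_qfact_diff_1[OF Q(1), of "int n + 1 - j"]
    unfolding a_def b_def R_def S_def by simp_all
  moreover have "int (Suc n) - j = int n + 1 - j" "int n - (j - 1) = int n + 1 - j"
    by simp_all
  ultimately have
    "qbinom Q (Suc n) j = qpoch n Q Q * (1 - a * b) * R * S"
    "qbinom Q n j = qpoch n Q Q * R * ((1 - b) * S)"
    "qbinom Q n (j - 1) = qpoch n Q Q * ((1 - a) * R) * S"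
    unfolding qbinom_def R_def S_def by (simp_all only:)
  then show "qbinom Q (Suc n) j = qbinom Q n (j - 1) + Q powi j * qbinom Q n j"
    "qbinom Q (Suc n) j = qbinom Q n j + Q powi (int n + 1 - j) * qbinom Q n (j - 1)"
    unfolding a_def[symmetric] b_def[symmetric] by algebra+
qed

lemma inverse_qpoch_self_bounded:
  fixes Q :: "'a :: {real_normed_field, banach}"
  assumes "norm Q < 1"
  obtains K where "\<And>n. norm (inverse (qpoch n Q Q)) \<le> K"
proof -
  have "convergent (\<lambda>n. inverse (qpoch n Q Q))"
    using tendsto_inverse[OF qpoch_tendsto[OF assms] qpoch_inf_self_nonzero[OF assms]]
    by (rule convergentI)
  then have "Bseq (\<lambda>n. inverse (qpoch n Q Q))"
    by (rule convergent_imp_Bseq)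
  then obtain K where "K > 0" "\<forall>n. norm (inverse (qpoch n Q Q)) \<le> K"
    by (rule BseqE)
  then show ?thesis
    by (intro that[of K]) simp
qed

lemma qbinom_bounded:
  fixes Q :: "'a :: {real_normed_field, banach}"
  assumes "norm Q < 1"
  obtains K where "\<And>n j. norm (qbinom Q n j) \<le> K"
proof -
  obtain A where A: "\<And>n. norm (qpoch n Q Q) \<le> A"
    using convergent_imp_Bseq[OF convergentI[OF qpoch_tendsto[OF assms]]] by (auto simp: Bseq_def)
  obtain B where B: "\<And>n. norm (inverse (qpoch n Q Q)) \<le> B"
    using inverse_qpoch_self_bounded[OF assms] by blast
  have A0: "A \<ge> 0" and B0: "B \<ge> 0"
    using order_trans[OF norm_ge_zero A] order_trans[OF norm_ge_zero B] by blast+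
  have "norm (inv_qfact Q j) \<le> B" for j
    using B B0 by (simp add: inv_qfact_def)
  then have "norm (qbinom Q n j) \<le> A * B * B" for n j
    unfolding qbinom_def norm_mult using A A0 B0 by (intro mult_mono) auto
  then show ?thesis by (rule that)
qed

lemma inv_qfact_tendsto:
  assumes "norm Q < 1"
  shows "(\<lambda>n. inv_qfact Q (int n + k)) \<longlonglongrightarrow> inverse (qpoch_inf Q Q)"
proof -
  have "filterlim (\<lambda>n. nat (int n + k)) at_top at_top"
    unfolding filterlim_at_top eventually_sequentially
  proof (intro allI exI impI)
    fix Z n :: nat assume "n \<ge> Z + nat \<bar>k\<bar>"
    then show "Z \<le> nat (int n + k)" by linarith
  qed
  then have "(\<lambda>n. inverse (qpoch (nat (int n + k)) Q Q)) \<longlonglongrightarrow> inverse (qpoch_inf Q Q)"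
    by (intro tendsto_inverse qpoch_inf_self_nonzero filterlim_compose[OF qpoch_tendsto] assms)
  moreover have "eventually (\<lambda>n. inv_qfact Q (int n + k) = inverse (qpoch (nat (int n + k)) Q Q)) sequentially"
    using eventually_ge_at_top[of "nat (- k)"] by eventually_elim (auto simp: inv_qfact_def)
  ultimately show ?thesis
    by (simp add: tendsto_cong)
qed

lemma central_qbinom_tendsto:
  assumes "norm Q < 1"
  shows "(\<lambda>n. qbinom Q (n + n) (int n + k)) \<longlonglongrightarrow> inverse (qpoch_inf Q Q)"
proof -
  have "(\<lambda>n. qpoch (n + n) Q Q) \<longlonglongrightarrow> qpoch_inf Q Q"
    using LIMSEQ_subseq_LIMSEQ[OF qpoch_tendsto[OF assms, of Q], of "\<lambda>n. n + n"]
    by (simp add: o_def strict_mono_def)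
  then have "(\<lambda>n. qpoch (n + n) Q Q * inv_qfact Q (int n + k) * inv_qfact Q (int n + - k)) \<longlonglongrightarrow>
      qpoch_inf Q Q * inverse (qpoch_inf Q Q) * inverse (qpoch_inf Q Q)"
    by (intro tendsto_mult inv_qfact_tendsto assms)
  then show ?thesis
    using qpoch_inf_self_nonzero[OF assms] by (simp add: qbinom_def)
qed

subsection \<open>The Jacobi triple product\<close>

lemma has_sum_int_shift:
  fixes f :: "int \<Rightarrow> 'a :: {comm_monoid_add, topological_space}"
  shows "((\<lambda>k. f (k + c)) has_sum S) UNIV \<longleftrightarrow> (f has_sum S) UNIV"
  by (rule has_sum_reindex_bij_witness[of _ "\<lambda>k. k - c" "\<lambda>k. k + c"]) auto

lemma summable_on_intI:
  fixes f :: "int \<Rightarrow> 'a :: topological_comm_monoid_add"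
  assumes "(\<lambda>n. f (int n)) summable_on UNIV" "(\<lambda>n. f (- int (Suc n))) summable_on UNIV"
  shows "f summable_on UNIV"
proof -
  have "f summable_on {0..}"
    using assms(1) summable_on_reindex_bij_witness[of UNIV nat int "{0..}" f "\<lambda>n. f (int n)"] by simp
  moreover have "f summable_on {..<0}"
    using assms(2) summable_on_reindex_bij_witness[of UNIV "\<lambda>k. nat (- k - 1)" "\<lambda>n. - int (Suc n)" "{..<0}" f]
    by simp
  ultimately have "f summable_on ({0..} \<union> {..<0})"
    by (rule summable_on_Un_disjoint) auto
  also have "{0..} \<union> {..<0} = (UNIV :: int set)"
    by auto
  finally show ?thesis .
qed

lemma tannery_infsum:
  fixes f :: "'b \<Rightarrow> 'c \<Rightarrow> 'a :: banach"
  assumes lim: "\<And>k. k \<in> A \<Longrightarrow> (f k \<longlongrightarrow> g k) F"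
    and bound: "\<And>k n. k \<in> A \<Longrightarrow> norm (f k n) \<le> M k"
    and M: "M summable_on A"
  shows "((\<lambda>n. \<Sum>\<^sub>\<infinity>k\<in>A. f k n) \<longlongrightarrow> (\<Sum>\<^sub>\<infinity>k\<in>A. g k)) F"
proof (cases "F = bot")
  case False
  show ?thesis
  proof (rule swap_uniform_limit')
    show "uniform_limit UNIV (\<lambda>X n. \<Sum>k\<in>X. f k n) (\<lambda>n. \<Sum>\<^sub>\<infinity>k\<in>A. f k n) (finite_subsets_at_top A)"
      using bound M by (intro Weierstrass_m_test_general) auto
    show "\<forall>\<^sub>F X in finite_subsets_at_top A. ((\<lambda>n. \<Sum>k\<in>X. f k n) \<longlongrightarrow> (\<Sum>k\<in>X. g k)) F"
      using lim by (intro eventually_finite_subsets_at_top_weakI tendsto_sum) auto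
    have "norm (g k) \<le> M k" if "k \<in> A" for k
      using False tendsto_norm[OF lim[OF that]] by (rule tendsto_upperbound[rotated 2]) (simp add: bound that)
    then have "g summable_on A"
      using abs_summable_summable[OF Infinite_Sum.abs_summable_on_comparison_test'[OF M]] by blast
    then show "((\<lambda>X. \<Sum>k\<in>X. g k) \<longlongrightarrow> (\<Sum>\<^sub>\<infinity>k\<in>A. g k)) (finite_subsets_at_top A)"
      by (simp flip: has_sum_def)
  qed auto
qed simp

definition theta_term :: "'a \<Rightarrow> 'a \<Rightarrow> int \<Rightarrow> 'a :: field" where
  "theta_term z Q n = Q powi (n * (n - 1) div 2) * z powi n"

lemma theta_term_add_1:
  assumes "Q \<noteq> 0" "z \<noteq> 0"
  shows "theta_term z Q (n + 1) = z * Q powi n * theta_term z Q n"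
proof -
  have "(n + 1) * (n + 1 - 1) = n * (n - 1) + n * 2"
    by (simp add: algebra_simps)
  then have "(n + 1) * (n + 1 - 1) div 2 = n * (n - 1) div 2 + n"
    by simp
  with assms show ?thesis
    by (simp add: theta_term_def power_int_add mult_ac)
qed

lemma theta_term_uminus:
  assumes "Q \<noteq> 0" "z \<noteq> 0"
  shows "theta_term z Q (- n) = theta_term (Q / z) Q n"
proof -
  have "- n * (- n - 1) = n * (n - 1) + n * 2"
    by (simp add: algebra_simps)
  then have "- n * (- n - 1) div 2 = n * (n - 1) div 2 + n"
    by simp
  with assms show ?thesis
    by (simp add: theta_term_def power_int_add power_int_minus power_int_divide_distrib divide_simps)
qed

lemma summable_theta_term_nat:
  fixes z Q :: "'a :: real_normed_field"
  assumes "norm Q < 1" "Q \<noteq> 0" "z \<noteq> 0"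
  shows "summable (\<lambda>n. norm (theta_term z Q (int n)))"
proof -
  have "(\<lambda>n. norm z * norm Q ^ n) \<longlonglongrightarrow> norm z * 0"
    using assms by (intro tendsto_intros LIMSEQ_power_zero) auto
  then have "eventually (\<lambda>n. norm z * norm Q ^ n < 1 / 2) sequentially"
    by (rule order_tendstoD) auto
  then obtain N where N: "\<And>n. n \<ge> N \<Longrightarrow> norm z * norm Q ^ n < 1 / 2"
    unfolding eventually_sequentially by blast
  show ?thesis
  proof (rule summable_ratio_test[of "1/2" N])
    fix n assume "n \<ge> N"
    have "norm (theta_term z Q (int (Suc n))) = norm z * norm Q ^ n * norm (theta_term z Q (int n))"
      using theta_term_add_1[of Q z "int n"] assms by (simp add: norm_mult norm_power add.commute)
    also have "\<dots> \<le> 1 / 2 * norm (theta_term z Q (int n))"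
      using N[OF \<open>n \<ge> N\<close>] by (intro mult_right_mono) auto
    finally show "norm (norm (theta_term z Q (int (Suc n)))) \<le> 1 / 2 * norm (norm (theta_term z Q (int n)))"
      by simp
  qed simp
qed

lemma abs_summable_theta_term:
  fixes z Q :: "'a :: real_normed_field"
  assumes "norm Q < 1" "Q \<noteq> 0" "z \<noteq> 0"
  shows "theta_term z Q abs_summable_on UNIV"
proof (rule summable_on_intI)
  show "(\<lambda>n. norm (theta_term z Q (int n))) summable_on UNIV"
    using summable_theta_term_nat[OF assms] by (simp add: summable_on_UNIV_nonneg_real_iff)
  have "summable (\<lambda>n. norm (theta_term (Q / z) Q (int (Suc n))))"
    using summable_theta_term_nat[of Q "Q / z"] assms by (subst summable_Suc_iff) auto
  then have "(\<lambda>n. norm (theta_term (Q / z) Q (int (Suc n)))) summable_on UNIV"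
    by (simp add: summable_on_UNIV_nonneg_real_iff del: of_nat_Suc)
  then show "(\<lambda>n. norm (theta_term z Q (- int (Suc n)))) summable_on UNIV"
    using assms(2,3) by (simp only: theta_term_uminus not_False_eq_True)
qed

lemma q_binomial_theorem:
  fixes z Q :: "'a :: real_normed_field"
  assumes Q: "norm Q < 1" "Q \<noteq> 0" and z: "z \<noteq> 0"
  shows "((\<lambda>k. theta_term (- z) Q k * qbinom Q n k) has_sum qpoch n z Q) UNIV"
proof (induction n)
  case 0
  show ?case
    by (rule has_sum_finite_neutralI[of "{0}"]) (auto simp: qbinom_0 theta_term_def)
next
  case (Suc n)
  let ?T = "theta_term (- z) Q"
  have step: "?T k * qbinom Q (Suc n) k =
      ?T k * qbinom Q n k + - z * Q ^ n * (?T (k - 1) * qbinom Q n (k - 1))" for k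
  proof -
    have "?T k * Q powi (int n + 1 - k) = - z * (Q powi (k - 1) * Q powi (int n + 1 - k)) * ?T (k - 1)"
      using theta_term_add_1[of Q "- z" "k - 1"] Q z by simp
    also have "Q powi (k - 1) * Q powi (int n + 1 - k) = Q ^ n"
      using Q by (simp flip: power_int_add)
    finally show ?thesis
      by (simp only: qbinom_Suc_right[OF Q] distrib_left mult.assoc[symmetric])
  qed
  have value_eq: "qpoch (Suc n) z Q = qpoch n z Q + - z * Q ^ n * qpoch n z Q"
    by (simp add: qpoch_Suc algebra_simps)
  show ?case
    unfolding step value_eq
    using Suc Suc[THEN has_sum_int_shift[where c = "- 1", THEN iffD2]]
    by (intro has_sum_add has_sum_cmult_right) simp_all
qed

lemma jacobi_triple_product_finite:
  fixes z Q :: "'a :: real_normed_field"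
  assumes Q: "norm Q < 1" "Q \<noteq> 0" and z: "z \<noteq> 0"
  shows "((\<lambda>k. theta_term (- z) Q k * qbinom Q (m + n) (int n + k)) has_sum
    qpoch m z Q * qpoch n (Q / z) Q) UNIV"
proof (induction n)
  case 0
  show ?case
    using q_binomial_theorem[OF assms] by simp
next
  case (Suc n)
  let ?T = "theta_term (- z) Q" and ?c = "\<lambda>k. qbinom Q (m + n) (int n + k)"
  have step: "?T k * qbinom Q (m + Suc n) (int (Suc n) + k) =
      ?T k * ?c k + - (Q / z) * Q ^ n * (?T (k + 1) * ?c (k + 1))" for k
  proof -
    have "qbinom Q (m + Suc n) (int (Suc n) + k) = ?c k + Q powi (int n + 1 + k) * ?c (k + 1)"
      using qbinom_Suc_left[OF Q, of "m + n" "int n + 1 + k"] by (simp add: algebra_simps)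
    moreover have "?T k * Q powi (int n + 1 + k) = - (Q / z) * Q ^ n * ?T (k + 1)"
      using theta_term_add_1[of Q "- z" k] Q z by (simp add: power_int_add mult_ac)
    ultimately show ?thesis
      by (simp only: distrib_left mult.assoc[symmetric])
  qed
  have value_eq: "qpoch m z Q * qpoch (Suc n) (Q / z) Q =
      qpoch m z Q * qpoch n (Q / z) Q + - (Q / z) * Q ^ n * (qpoch m z Q * qpoch n (Q / z) Q)"
    by (simp add: qpoch_Suc algebra_simps)
  show ?case
    unfolding step value_eq
    using Suc Suc[THEN has_sum_int_shift[where c = 1, THEN iffD2]]
    by (intro has_sum_add has_sum_cmult_right) simp_all
qed

theorem jacobi_triple_product:
  fixes z Q :: "'a :: {real_normed_field, banach}"
  assumes Q: "norm Q < 1" "Q \<noteq> 0" and z: "z \<noteq> 0"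
  shows "infsum (theta_term (- z) Q) UNIV = qpoch_inf Q Q * mod_theta z Q"
proof -
  let ?T = "theta_term (- z) Q" and ?E = "qpoch_inf Q Q"
  let ?f = "\<lambda>k n. ?T k * qbinom Q (n + n) (int n + k)"
  obtain K where K: "\<And>n j. norm (qbinom Q n j) \<le> K"
    using qbinom_bounded[OF Q(1)] by blast
  have "(\<lambda>n. \<Sum>\<^sub>\<infinity>k. ?f k n) \<longlonglongrightarrow> (\<Sum>\<^sub>\<infinity>k. ?T k * inverse ?E)"
  proof (rule tannery_infsum)
    show "?f k \<longlonglongrightarrow> ?T k * inverse ?E" for k
      by (intro tendsto_intros central_qbinom_tendsto Q)
    show "norm (?f k n) \<le> norm (?T k) * K" for k n
      unfolding norm_mult by (intro mult_left_mono K norm_ge_zero)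
    show "(\<lambda>k. norm (?T k) * K) summable_on UNIV"
      using abs_summable_theta_term[of Q "- z"] Q z by (intro summable_on_cmult_left) simp
  qed
  moreover have "(\<Sum>\<^sub>\<infinity>k. ?f k n) = qpoch n z Q * qpoch n (Q / z) Q" for n
    by (rule infsumI[OF jacobi_triple_product_finite[OF Q z]])
  moreover have "(\<lambda>n. qpoch n z Q * qpoch n (Q / z) Q) \<longlonglongrightarrow> mod_theta z Q"
    unfolding mod_theta_def by (intro tendsto_mult qpoch_tendsto Q)
  ultimately have "infsum ?T UNIV * inverse ?E = mod_theta z Q"
    by (simp add: infsum_cmult_left' LIMSEQ_unique)
  then show ?thesis
    using qpoch_inf_self_nonzero[OF Q(1)] by (simp add: field_simps)
qed

subsection \<open>The Weierstrass addition formula\<close>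

lemma has_sum_product:
  fixes f :: "'b \<Rightarrow> 'a :: {real_normed_field, banach}" and g :: "'c \<Rightarrow> 'a"
  assumes f: "f abs_summable_on A" and g: "g abs_summable_on B"
  shows "((\<lambda>(x, y). f x * g y) has_sum (infsum f A * infsum g B)) (A \<times> B)"
proof (rule has_sum_SigmaI)
  show "((\<lambda>y. case (x, y) of (x, y) \<Rightarrow> f x * g y) has_sum f x * infsum g B) B" for x
    using has_sum_cmult_right[OF has_sum_infsum[OF abs_summable_summable[OF g]]] by simp
  show "((\<lambda>x. f x * infsum g B) has_sum infsum f A * infsum g B) A"
    by (rule has_sum_cmult_left[OF has_sum_infsum[OF abs_summable_summable[OF f]]])
  have "(\<lambda>z. norm (case z of (x, y) \<Rightarrow> f x * g y)) summable_on A \<times> B"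
  proof (rule summable_on_SigmaI)
    show "((\<lambda>y. norm (case (x, y) of (x, y) \<Rightarrow> f x * g y)) has_sum
        norm (f x) * infsum (\<lambda>y. norm (g y)) B) B" for x
      using has_sum_cmult_right[OF has_sum_infsum[OF g], of "norm (f x)"] by (simp add: norm_mult)
    show "(\<lambda>x. norm (f x) * infsum (\<lambda>y. norm (g y)) B) summable_on A"
      by (intro summable_on_cmult_left f)
  qed simp
  then show "(\<lambda>(x, y). f x * g y) summable_on A \<times> B"
    by (rule abs_summable_summable)
qed

lemma has_sum_int_pairs_by_parity:
  fixes f :: "int \<Rightarrow> int \<Rightarrow> 'a :: topological_comm_monoid_add"
  assumes even: "((\<lambda>(i, j). f (i + j) (i - j)) has_sum a) UNIV"
    and odd: "((\<lambda>(i, j). f (i + j + 1) (i - j)) has_sum b) UNIV"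
  shows "((\<lambda>(m, n). f m n) has_sum (a + b)) UNIV"
proof -
  let ?E = "{(m, n). even (m + n :: int)}" and ?O = "{(m, n). odd (m + n :: int)}"
  have "((\<lambda>(m, n). f m n) has_sum a) ?E"
    using even
    by (rule has_sum_reindex_bij_witness[of UNIV "\<lambda>(m, n). ((m + n) div 2, (m - n) div 2)"
        "\<lambda>(i, j). (i + j, i - j)" ?E, THEN iffD1, rotated -1]) (auto | presburger)+
  moreover have "((\<lambda>(m, n). f m n) has_sum b) ?O"
    using odd
    by (rule has_sum_reindex_bij_witness[of UNIV "\<lambda>(m, n). ((m + n) div 2, (m - n) div 2)"
        "\<lambda>(i, j). (i + j + 1, i - j)" ?O, THEN iffD1, rotated -1]) (auto | presburger)+
  ultimately have "((\<lambda>(m, n). f m n) has_sum (a + b)) (?E \<union> ?O)"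
    by (rule has_sum_Un_disjoint) auto
  also have "?E \<union> ?O = UNIV"
    by auto
  finally show ?thesis .
qed

lemma theta_term_times_even:
  fixes x y Q :: "'a :: field"
  assumes "Q \<noteq> 0" "x \<noteq> 0" "y \<noteq> 0"
  shows "theta_term (x * y) Q (i + j) * theta_term (x / y) Q (i - j) =
    theta_term (x\<^sup>2) (Q\<^sup>2) i * theta_term (Q * y\<^sup>2) (Q\<^sup>2) j"
proof -
  define t where "t n = n * (n - 1) div 2" for n :: int
  have two_t: "2 * t n = n * n - n" for n
    by (simp add: t_def right_diff_distrib)
  have "2 * (t (i + j) + t (i - j)) = 2 * (2 * t i + 2 * t j + j)"
    unfolding distrib_left two_t by (simp add: two_t algebra_simps)
  then have "t (i + j) + t (i - j) = 2 * t i + 2 * t j + j"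
    by simp
  then have "Q powi t (i + j) * Q powi t (i - j) = (Q\<^sup>2) powi t i * (Q\<^sup>2) powi t j * Q powi j"
    using assms by (simp add: power_int_add power_int_mult flip: power_int_add[of Q "t (i + j)"])
  moreover have "(x * y) powi (i + j) * (x / y) powi (i - j) = (x\<^sup>2) powi i * (y\<^sup>2) powi j"
    using assms
    by (simp add: power_int_mult_distrib power_int_divide_distrib power_int_add power_int_diff power2_eq_square)
  ultimately show ?thesis
    unfolding theta_term_def t_def[symmetric] power_int_mult_distrib by algebra
qed

lemma theta_term_times_odd:
  fixes x y Q :: "'a :: field"
  assumes "Q \<noteq> 0" "x \<noteq> 0" "y \<noteq> 0"
  shows "theta_term (x * y) Q (i + j + 1) * theta_term (x / y) Q (i - j) =
    x * y * (theta_term (Q * x\<^sup>2) (Q\<^sup>2) i * theta_term (Q\<^sup>2 * y\<^sup>2) (Q\<^sup>2) j)"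
proof -
  have "theta_term (x * y) Q (i + j + 1) * theta_term (x / y) Q (i - j) =
      x * y * Q powi (i + j) * (theta_term (x\<^sup>2) (Q\<^sup>2) i * theta_term (Q * y\<^sup>2) (Q\<^sup>2) j)"
    using assms by (simp add: theta_term_add_1 flip: theta_term_times_even)
  then show ?thesis
    using assms by (simp add: theta_term_def power_int_add power_int_mult_distrib power2_eq_square)
qed

definition theta_series :: "'a \<Rightarrow> 'a \<Rightarrow> 'a :: {real_normed_field, banach}" where
  "theta_series z Q = infsum (theta_term z Q) UNIV"

lemma theta_series_shift:
  assumes "norm Q < 1" "Q \<noteq> 0" "z \<noteq> 0"
  shows "theta_series z Q = z * theta_series (Q * z) Q"
proof -
  have "theta_term z Q (k + 1) = z * theta_term (Q * z) Q k" for k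
    using assms theta_term_add_1[of Q z k] by (simp add: theta_term_def power_int_mult_distrib)
  then have "((\<lambda>k. z * theta_term (Q * z) Q k) has_sum theta_series z Q) UNIV"
    using has_sum_int_shift[of "theta_term z Q" 1] abs_summable_summable[OF abs_summable_theta_term[OF assms]]
    by (simp add: theta_series_def)
  from infsumI[OF this] show ?thesis
    by (simp add: theta_series_def infsum_cmult_right')
qed

lemma theta_series_times:
  assumes Q: "norm Q < 1" "Q \<noteq> 0" and nz: "x \<noteq> 0" "y \<noteq> 0"
  shows "theta_series (x * y) Q * theta_series (x / y) Q =
    theta_series (x\<^sup>2) (Q\<^sup>2) * theta_series (Q * y\<^sup>2) (Q\<^sup>2) +
    x * y * (theta_series (Q * x\<^sup>2) (Q\<^sup>2) * theta_series (Q\<^sup>2 * y\<^sup>2) (Q\<^sup>2))"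
proof -
  have Q2: "norm (Q\<^sup>2) < 1" "Q\<^sup>2 \<noteq> 0"
    using Q by (simp_all add: norm_power power_less_one_iff)
  have product: "((\<lambda>(i, j). theta_term a P i * theta_term b P j) has_sum
      theta_series a P * theta_series b P) UNIV"
    if "norm P < 1" "P \<noteq> 0" "a \<noteq> 0" "b \<noteq> 0" for a b P :: 'a
    using has_sum_product[OF abs_summable_theta_term abs_summable_theta_term, of P a P b] that
    by (simp add: theta_series_def)
  have "((\<lambda>(m, n). theta_term (x * y) Q m * theta_term (x / y) Q n) has_sum
      (theta_series (x\<^sup>2) (Q\<^sup>2) * theta_series (Q * y\<^sup>2) (Q\<^sup>2) +
       x * y * (theta_series (Q * x\<^sup>2) (Q\<^sup>2) * theta_series (Q\<^sup>2 * y\<^sup>2) (Q\<^sup>2)))) UNIV"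
  proof (rule has_sum_int_pairs_by_parity)
    show "((\<lambda>(i, j). theta_term (x * y) Q (i + j) * theta_term (x / y) Q (i - j)) has_sum
        theta_series (x\<^sup>2) (Q\<^sup>2) * theta_series (Q * y\<^sup>2) (Q\<^sup>2)) UNIV"
      unfolding theta_term_times_even[OF Q(2) nz] using Q2 Q nz by (intro product) auto
    have "((\<lambda>(i, j). x * y * (theta_term (Q * x\<^sup>2) (Q\<^sup>2) i * theta_term (Q\<^sup>2 * y\<^sup>2) (Q\<^sup>2) j)) has_sum
        x * y * (theta_series (Q * x\<^sup>2) (Q\<^sup>2) * theta_series (Q\<^sup>2 * y\<^sup>2) (Q\<^sup>2))) UNIV"
      using has_sum_cmult_right[OF product, of "Q\<^sup>2" "Q * x\<^sup>2" "Q\<^sup>2 * y\<^sup>2" "x * y"] Q2 Q nz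
      by (simp add: case_prod_unfold)
    then show "((\<lambda>(i, j). theta_term (x * y) Q (i + j + 1) * theta_term (x / y) Q (i - j)) has_sum
        x * y * (theta_series (Q * x\<^sup>2) (Q\<^sup>2) * theta_series (Q\<^sup>2 * y\<^sup>2) (Q\<^sup>2))) UNIV"
      unfolding theta_term_times_odd[OF Q(2) nz] .
  qed
  with product[of Q "x * y" "x / y"] show ?thesis
    using Q nz by (intro has_sum_unique) auto
qed

text \<open>
  The bracket is a \<open>2 \<times> 2\<close> determinant with one column depending on \<open>x\<close> and one on \<open>y\<close>, so that the
  addition formula below is the Pluecker relation for such determinants.
\<close>

lemma mod_theta_times:
  assumes Q: "norm Q < 1" "Q \<noteq> 0" and nz: "x \<noteq> 0" "y \<noteq> 0"
  shows "(qpoch_inf Q Q)\<^sup>2 * (mod_theta (x * y) Q * mod_theta (x / y) Q) =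
    x * ((x * theta_series (Q\<^sup>2 * x\<^sup>2) (Q\<^sup>2)) * theta_series (Q * y\<^sup>2) (Q\<^sup>2) -
         theta_series (Q * x\<^sup>2) (Q\<^sup>2) * (y * theta_series (Q\<^sup>2 * y\<^sup>2) (Q\<^sup>2)))"
proof -
  have "(qpoch_inf Q Q)\<^sup>2 * (mod_theta (x * y) Q * mod_theta (x / y) Q) =
      theta_series (- x * y) Q * theta_series (- x / y) Q"
    using jacobi_triple_product[OF Q, of "x * y"] jacobi_triple_product[OF Q, of "x / y"] nz
    by (simp add: theta_series_def power2_eq_square mult_ac)
  also have "\<dots> = theta_series (x\<^sup>2) (Q\<^sup>2) * theta_series (Q * y\<^sup>2) (Q\<^sup>2) -
      x * y * (theta_series (Q * x\<^sup>2) (Q\<^sup>2) * theta_series (Q\<^sup>2 * y\<^sup>2) (Q\<^sup>2))"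
    using theta_series_times[OF Q, of "- x" y] nz by simp
  also have "theta_series (x\<^sup>2) (Q\<^sup>2) = x * (x * theta_series (Q\<^sup>2 * x\<^sup>2) (Q\<^sup>2))"
  proof -
    have "norm (Q\<^sup>2) < 1"
      using Q by (simp add: norm_power power_less_one_iff)
    from theta_series_shift[OF this, of "x\<^sup>2"] show ?thesis
      using Q nz by (simp add: power2_eq_square mult.assoc)
  qed
  finally show ?thesis
    by (simp add: algebra_simps)
qed

theorem weierstrass_addition:
  fixes Q x y z w :: "'a :: {real_normed_field, banach}"
  assumes Q: "norm Q < 1" "Q \<noteq> 0" and nz: "x \<noteq> 0" "y \<noteq> 0" "z \<noteq> 0" "w \<noteq> 0"
  defines "th \<equiv> \<lambda>z. mod_theta z Q"
  shows "y * (th (x * y) * th (x / y) * th (z * w) * th (z / w)) =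
    z * (th (x * z) * th (x / z) * th (y * w) * th (y / w) - th (x * w) * th (x / w) * th (y * z) * th (y / z))"
proof -
  define E where "E = qpoch_inf Q Q"
  define u v where "u = (\<lambda>z. z * theta_series (Q\<^sup>2 * z\<^sup>2) (Q\<^sup>2))" and "v = (\<lambda>z. theta_series (Q * z\<^sup>2) (Q\<^sup>2))"
  have E: "E \<noteq> 0"
    using qpoch_inf_self_nonzero[OF Q(1)] by (simp add: E_def)
  have determinant: "E\<^sup>2 * (th (a * b) * th (a / b)) = a * (u a * v b - v a * u b)" if "a \<noteq> 0" "b \<noteq> 0" for a b
    unfolding E_def th_def u_def v_def by (rule mod_theta_times[OF Q that])
  have "E\<^sup>2 * E\<^sup>2 * (y * (th (x * y) * th (x / y) * th (z * w) * th (z / w))) =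
      y * (E\<^sup>2 * (th (x * y) * th (x / y))) * (E\<^sup>2 * (th (z * w) * th (z / w)))"
    by (simp add: mult_ac)
  also have "\<dots> = z * ((E\<^sup>2 * (th (x * z) * th (x / z))) * (E\<^sup>2 * (th (y * w) * th (y / w)))
      - (E\<^sup>2 * (th (x * w) * th (x / w))) * (E\<^sup>2 * (th (y * z) * th (y / z))))"
    unfolding determinant[OF nz(1,2)] determinant[OF nz(3,4)] determinant[OF nz(1,3)]
      determinant[OF nz(2,4)] determinant[OF nz(1,4)] determinant[OF nz(2,3)]
    by algebra
  also have "\<dots> = E\<^sup>2 * E\<^sup>2 * (z * (th (x * z) * th (x / z) * th (y * w) * th (y / w)
      - th (x * w) * th (x / w) * th (y * z) * th (y / z)))"
    by algebra
  finally show ?thesis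
    using E by simp
qed

subsection \<open>Generating functions of partitions\<close>

lemma finite_partitions:
  assumes "0 \<notin> S"
  shows "finite {P :: nat multiset. set_mset P \<subseteq> S \<and> sum_mset P = n}"
proof (rule finite_subset)
  have size: "size P \<le> sum_mset P" if "0 \<notin># P" for P :: "nat multiset"
    using that by (induction P) (auto simp: Suc_le_eq)
  show "{P. set_mset P \<subseteq> S \<and> sum_mset P = n} \<subseteq> mset ` {xs. set xs \<subseteq> {..n} \<and> length xs \<le> n}"
  proof
    fix P assume "P \<in> {P. set_mset P \<subseteq> S \<and> sum_mset P = n}"
    then have P: "set_mset P \<subseteq> S" "sum_mset P = n" by auto
    obtain xs where xs: "mset xs = P" using ex_mset by blast
    have "length xs \<le> n"
      using size[of P] P assms xs by (auto simp flip: size_mset)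
    moreover have "set xs \<subseteq> {..n}"
      using P xs by (auto simp flip: set_mset_mset dest!: multi_member_split)
    ultimately show "P \<in> mset ` {xs. set xs \<subseteq> {..n} \<and> length xs \<le> n}"
      using xs by blast
  qed
  show "finite (mset ` {xs. set xs \<subseteq> {..n} \<and> length xs \<le> n})"
    by (intro finite_imageI finite_lists_length_le) simp
qed

lemma partition_count_mono: "0 \<notin> T \<Longrightarrow> S \<subseteq> T \<Longrightarrow> partition_count S n \<le> partition_count T n"
  unfolding partition_count_def by (intro card_mono finite_partitions) auto

lemma partition_count_Int_atMost:
  assumes "n \<le> N"
  shows "partition_count (S \<inter> {..N}) n = partition_count S n"
proof -
  have "x \<le> sum_mset P" if "x \<in># P" for x and P :: "nat multiset"
    using that by (auto dest!: multi_member_split)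
  then have "{P. set_mset P \<subseteq> S \<inter> {..N} \<and> sum_mset P = n} = {P. set_mset P \<subseteq> S \<and> sum_mset P = n}"
    using assms by force
  then show ?thesis
    by (simp add: partition_count_def)
qed

lemma partition_count_empty: "partition_count {} n = (if n = 0 then 1 else 0)"
  by (auto simp: partition_count_def cong: conj_cong)

lemma partition_count_insert:
  assumes "0 \<notin> S" "s > 0" "s \<notin> S"
  shows "partition_count (insert s S) n =
    partition_count S n + (if s \<le> n then partition_count (insert s S) (n - s) else 0)"
proof -
  let ?A = "\<lambda>S n. {P :: nat multiset. set_mset P \<subseteq> S \<and> sum_mset P = n}"
  let ?B = "{P \<in> ?A (insert s S) n. s \<in># P}"
  have finite: "finite (?A (insert s S) n)" "finite (?A S n)"
    using assms by (auto intro: finite_partitions)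
  have split: "?A (insert s S) n = ?A S n \<union> ?B" "?A S n \<inter> ?B = {}"
    using assms by auto
  have "card (?A (insert s S) n) = card (?A S n) + card ?B"
    using finite split by (metis (no_types, lifting) card_Un_disjoint finite_Un)
  moreover have "?B = (if s \<le> n then add_mset s ` ?A (insert s S) (n - s) else {})"
  proof (intro equalityI subsetI)
    fix P assume "P \<in> ?B"
    then obtain P' where "P = add_mset s P'" "P \<in> ?A (insert s S) n"
      by (auto dest: multi_member_split)
    then show "P \<in> (if s \<le> n then add_mset s ` ?A (insert s S) (n - s) else {})" by auto
  qed (auto split: if_splits)
  ultimately show ?thesis
    by (simp add: partition_count_def card_image inj_on_def)
qed

lemma partition_count_insert_convolution:
  assumes S: "0 \<notin> S" "s > 0" "s \<notin> S"
  shows "partition_count (insert s S) n = (\<Sum>i\<le>n. if s dvd i then partition_count S (n - i) else 0)"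
proof (induction n rule: less_induct)
  case (less n)
  let ?M = "\<lambda>n. {i \<in> {..n}. s dvd i}"
  have "partition_count (insert s S) n = (\<Sum>i\<in>?M n. partition_count S (n - i))"
  proof (cases "s \<le> n")
    case True
    have "?M n = insert 0 ((\<lambda>i. i + s) ` ?M (n - s))"
    proof (intro equalityI subsetI)
      fix i assume "i \<in> ?M n"
      then show "i \<in> insert 0 ((\<lambda>i. i + s) ` ?M (n - s))"
        using S(2) by (cases "i = 0") (auto intro!: image_eqI[of _ _ "i - s"] dest: dvd_imp_le)
    qed (use True in auto)
    then have "(\<Sum>i\<in>?M n. partition_count S (n - i)) =
        partition_count S n + (\<Sum>i\<in>?M (n - s). partition_count S (n - s - i))"
      using S(2) by (simp add: sum.reindex inj_on_def image_iff add.commute)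
    also have "(\<Sum>i\<in>?M (n - s). partition_count S (n - s - i)) = partition_count (insert s S) (n - s)"
      unfolding sum.inter_filter[OF finite_atMost] using less[of "n - s"] S(2) True by simp
    finally show ?thesis
      using partition_count_insert[OF S, of n] True by simp
  next
    case False
    then have "?M n = {0}"
      by (auto dest: dvd_imp_le)
    then show ?thesis
      using partition_count_insert[OF S, of n] False by simp
  qed
  then show ?case
    by (simp only: sum.inter_filter finite_atMost)
qed

lemma geometric_sums_multiples:
  fixes q :: "'a :: {real_normed_field, banach}"
  assumes "norm q < 1" "s > 0"
  shows "(\<lambda>n. if s dvd n then q ^ n else 0) sums inverse (1 - q ^ s)"
    and "summable (\<lambda>n. norm (if s dvd n then q ^ n else 0))"
proof -
  have "norm (q ^ s) < 1"
    using assms by (simp add: norm_power power_less_one_iff)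
  then have "(\<lambda>k. if s dvd s * k then q ^ (s * k) else 0) sums inverse (1 - q ^ s)"
    using geometric_sums[of "q ^ s"] by (simp add: power_mult divide_inverse)
  then show "(\<lambda>n. if s dvd n then q ^ n else 0) sums inverse (1 - q ^ s)"
    by (subst (asm) sums_mono_reindex) (use assms in \<open>auto simp: strict_mono_def dvd_def\<close>)
  show "summable (\<lambda>n. norm (if s dvd n then q ^ n else 0))"
    using assms by (intro summable_comparison_test'[OF summable_geometric[of "norm q"]]) (auto simp: norm_power)
qed

lemma partition_count_insert_times_power:
  fixes q :: "'a :: comm_semiring_1"
  assumes "0 \<notin> S" "s > 0" "s \<notin> S"
  shows "of_nat (partition_count (insert s S) n) * q ^ n =
    (\<Sum>i\<le>n. (if s dvd i then q ^ i else 0) * (of_nat (partition_count S (n - i)) * q ^ (n - i)))"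
  unfolding partition_count_insert_convolution[OF assms] of_nat_sum sum_distrib_right
  by (intro sum.cong) (auto simp: mult.left_commute simp flip: power_add)

lemma partition_gf_finite:
  fixes q :: "'a :: {real_normed_field, banach}"
  assumes "finite S" "0 \<notin> S" "norm q < 1"
  shows "(\<lambda>n. of_nat (partition_count S n) * q ^ n) sums (\<Prod>s\<in>S. inverse (1 - q ^ s))"
proof -
  let ?a = "\<lambda>S n. of_nat (partition_count S n) * q ^ n"
  have "?a S sums (\<Prod>s\<in>S. inverse (1 - q ^ s)) \<and> summable (\<lambda>n. norm (?a S n))"
    using assms(1,2)
  proof (induction S rule: finite_induct)
    case empty
    have "?a {} = (\<lambda>n. if n = 0 then 1 else 0)"
      by (auto simp: partition_count_empty)
    then have "?a {} sums (\<Prod>s\<in>{}. inverse (1 - q ^ s))"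
      using sums_single[of 0 "\<lambda>_. 1 :: 'a"] by simp
    moreover have "summable (\<lambda>n. norm (?a {} n))"
      by (rule summable_finite[of "{0}"]) (auto simp: partition_count_empty)
    ultimately show ?case ..
  next
    case (insert s S)
    let ?g = "\<lambda>i. if s dvd i then q ^ i else 0"
    have s: "0 \<notin> S" "s > 0" "s \<notin> S"
      using insert by (auto intro: gr0I)
    have g: "?g sums inverse (1 - q ^ s)" "summable (\<lambda>i. norm (?g i))"
      using geometric_sums_multiples[OF assms(3) s(2)] .
    have aS: "?a S sums (\<Prod>s\<in>S. inverse (1 - q ^ s))" "summable (\<lambda>n. norm (?a S n))"
      using insert s by auto
    have "?a (insert s S) sums (suminf ?g * suminf (?a S))"
      unfolding partition_count_insert_times_power[OF s] by (rule Cauchy_product_sums[OF g(2) aS(2)])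
    then have "?a (insert s S) sums (\<Prod>s\<in>insert s S. inverse (1 - q ^ s))"
      using insert sums_unique[OF g(1)] sums_unique[OF aS(1)] by simp
    moreover have "norm (?a (insert s S) n) = (\<Sum>i\<le>n. norm (?g i) * norm (?a S (n - i)))" for n
      using partition_count_insert_times_power[OF s, of n "norm q"]
      by (simp add: norm_mult norm_power if_distrib[of norm] cong: if_cong)
    then have "summable (\<lambda>n. norm (?a (insert s S) n))"
      using summable_Cauchy_product[of "\<lambda>i. norm (?g i)" "\<lambda>n. norm (?a S n)"] g(2) aS(2) by simp
    ultimately show ?case
      by blast
  qed
  then show ?thesis ..
qed

lemma abs_summable_partition_gf:
  fixes q :: "'a :: {real_normed_field, banach}"
  assumes S: "0 \<notin> S" and q: "norm q < 1"
  shows "summable (\<lambda>n. norm (of_nat (partition_count S n) * q ^ n))"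
proof -
  define r where "r = norm q"
  have r: "0 \<le> r" "norm r < 1"
    using q by (simp_all add: r_def)
  obtain K where K: "\<And>n. norm (inverse (qpoch n r r)) \<le> K"
    using inverse_qpoch_self_bounded[OF r(2)] by blast
  have "(\<Sum>n<N. of_nat (partition_count S n) * r ^ n) \<le> K" for N
  proof -
    have "(\<Sum>n<N. of_nat (partition_count S n) * r ^ n) = (\<Sum>n<N. of_nat (partition_count (S \<inter> {..N}) n) * r ^ n)"
      by (intro sum.cong) (auto simp: partition_count_Int_atMost)
    also have "\<dots> \<le> (\<Sum>n<N. of_nat (partition_count {1..N} n) * r ^ n)"
      using S r
      by (intro sum_mono mult_right_mono of_nat_mono partition_count_mono) (auto simp: Suc_le_eq intro: gr0I)
    also have "\<dots> \<le> (\<Sum>n. of_nat (partition_count {1..N} n) * r ^ n)"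
      using r by (intro sum_le_suminf sums_summable[OF partition_gf_finite]) auto
    also have "\<dots> = (\<Prod>s\<in>{1..N}. inverse (1 - r ^ s))"
      using r by (intro sums_unique[symmetric] partition_gf_finite) auto
    also have "\<dots> = inverse (qpoch N r r)"
      by (simp add: qpoch_def prod_inversef[unfolded o_def] prod.atLeast1_atMost_eq)
    also have "\<dots> \<le> norm (inverse (qpoch N r r))"
      unfolding real_norm_def by (rule abs_ge_self)
    also have "\<dots> \<le> K"
      by (rule K)
    finally show ?thesis .
  qed
  then have "summable (\<lambda>n. of_nat (partition_count S n) * r ^ n)"
    using r by (intro summableI_nonneg_bounded) auto
  then show ?thesis
    by (simp add: norm_mult norm_power r_def)
qed

theorem partition_gf_tendsto:
  fixes q :: "'a :: {real_normed_field, banach}"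
  assumes S: "0 \<notin> S" and q: "norm q < 1"
  shows "(\<lambda>N. \<Prod>s\<in>S \<inter> {..N}. inverse (1 - q ^ s)) \<longlonglongrightarrow> (\<Sum>n. of_nat (partition_count S n) * q ^ n)"
proof -
  let ?a = "\<lambda>n N. of_nat (partition_count (S \<inter> {..N}) n) * q ^ n"
  have "(\<lambda>N. \<Sum>n. ?a n N) \<longlonglongrightarrow> (\<Sum>n. of_nat (partition_count S n) * q ^ n)"
  proof (rule tannerys_theorem[THEN conjunct2, THEN conjunct2])
    show "?a n \<longlonglongrightarrow> of_nat (partition_count S n) * q ^ n" for n
      by (rule tendsto_eventually)
        (use eventually_ge_at_top[of n] in \<open>eventually_elim, simp add: partition_count_Int_atMost\<close>)
    have "norm (?a n N) \<le> norm (of_nat (partition_count S n) * q ^ n)" for n N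
      using S by (auto simp: norm_mult intro!: mult_right_mono partition_count_mono)
    then show "\<forall>\<^sub>F (n, N) in sequentially \<times>\<^sub>F sequentially.
        norm (?a n N) \<le> norm (of_nat (partition_count S n) * q ^ n)"
      by (simp add: case_prod_unfold)
    show "summable (\<lambda>n. norm (of_nat (partition_count S n) * q ^ n))"
      using abs_summable_partition_gf[OF assms] .
  qed simp
  moreover have "(\<Sum>n. ?a n N) = (\<Prod>s\<in>S \<inter> {..N}. inverse (1 - q ^ s))" for N
    using assms by (intro sums_unique[symmetric] partition_gf_finite) auto
  ultimately show ?thesis
    by simp
qed

lemma prod_residue_classes:
  fixes f :: "int \<Rightarrow> 'a :: comm_monoid_mult"
  assumes C: "C \<subseteq> {0<..<M}"
  shows "(\<Prod>s\<in>{n. int n mod M \<in> C} \<inter> {..nat M * N}. f (int s)) = (\<Prod>c\<in>C. \<Prod>i<N. f (M * int i + c))"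
proof -
  have "(\<Prod>s\<in>{n. int n mod M \<in> C} \<inter> {..nat M * N}. f (int s)) = (\<Prod>(c, i)\<in>C \<times> {..<N}. f (M * int i + c))"
  proof (rule prod.reindex_bij_witness[of _ "\<lambda>(c, i). nat (M * int i + c)"
        "\<lambda>s. (int s mod M, nat (int s div M))"])
    fix s assume s: "s \<in> {n. int n mod M \<in> C} \<inter> {..nat M * N}"
    then have M: "0 < int s mod M" "M > 0"
      using C by auto
    have "int s \<le> M * int N"
      using s M(2) by (simp flip: of_nat_le_iff[where 'a = int])
    then have "M * (int s div M) < M * int N"
      using mult_div_mod_eq[of M "int s"] M(1) by linarith
    then have "int s div M < int N"
      using M(2) by simp
    with s M show "(int s mod M, nat (int s div M)) \<in> C \<times> {..<N}"
      by (auto simp: nat_less_iff pos_imp_zdiv_nonneg_iff)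
  next
    fix p assume "p \<in> C \<times> {..<N}"
    then obtain c i where p: "p = (c, i)" "c \<in> C" "i < N" "0 < c" "c < M"
      using C by auto
    have "M * int i + c \<le> M * int N"
      using p mult_left_mono[of "int i + 1" "int N" M] by (simp add: algebra_simps)
    with p show "(case p of (c, i) \<Rightarrow> nat (M * int i + c)) \<in> {n. int n mod M \<in> C} \<inter> {..nat M * N}"
      by (auto simp flip: of_nat_le_iff[where 'a = int])
  qed (use C in \<open>auto simp: pos_imp_zdiv_nonneg_iff\<close>)
  then show ?thesis
    by (simp add: prod.cartesian_product)
qed

theorem partition_gf_residue_classes:
  fixes q :: "'a :: {real_normed_field, banach}"
  assumes C: "C \<subseteq> {0<..<M}" and M: "M > 0" and q: "norm q < 1" "q \<noteq> 0"
  defines "S \<equiv> {n. int n mod M \<in> C}"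
  shows "(\<lambda>n. of_nat (partition_count S n) * q ^ n) sums inverse (\<Prod>c\<in>C. qpoch_inf (q powi c) (q powi M))"
proof -
  define Q where "Q = q powi M"
  have Q: "norm Q < 1"
    using q M by (simp add: Q_def power_int_def norm_power power_less_one_iff)
  have "finite C" and S: "0 \<notin> S"
    using C finite_subset by (auto simp: S_def)
  have "(\<lambda>N. inverse (\<Prod>c\<in>C. qpoch N (q powi c) Q)) \<longlonglongrightarrow> inverse (\<Prod>c\<in>C. qpoch_inf (q powi c) Q)"
  proof (intro tendsto_inverse tendsto_prod qpoch_tendsto Q)
    have "qpoch_inf (q powi c) Q \<noteq> 0" if "c \<in> C" for c
    proof (rule qpoch_inf_nonzero[OF Q])
      fix i
      have "c + M * int i > 0"
        using C that M by (intro add_pos_nonneg) auto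
      then have "q powi (c + M * int i) \<noteq> 1"
        using power_neq_1[OF q(1), of "nat (c + M * int i)"] by (simp add: power_int_def)
      then show "q powi c * Q ^ i \<noteq> 1"
        using q by (simp add: Q_def power_int_add power_int_power')
    qed
    then show "(\<Prod>c\<in>C. qpoch_inf (q powi c) Q) \<noteq> 0"
      using \<open>finite C\<close> by simp
  qed
  moreover have "(\<Prod>s\<in>S \<inter> {..nat M * N}. inverse (1 - q ^ s)) = inverse (\<Prod>c\<in>C. qpoch N (q powi c) Q)" for N
    using prod_residue_classes[OF C, where f = "\<lambda>n. 1 - q powi n"] q
    by (simp add: S_def qpoch_def Q_def power_int_add power_int_power' mult.commute
        prod_inversef[unfolded o_def])
  moreover have "(\<lambda>N. \<Prod>s\<in>S \<inter> {..nat M * N}. inverse (1 - q ^ s)) \<longlonglongrightarrow> (\<Sum>n. of_nat (partition_count S n) * q ^ n)"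
    using LIMSEQ_subseq_LIMSEQ[OF partition_gf_tendsto[OF S q(1)], of "\<lambda>N. nat M * N"] M
    by (simp add: o_def strict_mono_def)
  ultimately have "(\<Sum>n. of_nat (partition_count S n) * q ^ n) = inverse (\<Prod>c\<in>C. qpoch_inf (q powi c) Q)"
    using LIMSEQ_unique by auto
  then show ?thesis
    using summable_norm_cancel[OF abs_summable_partition_gf[OF S q(1)]] by (simp add: sums_iff Q_def)
qed

lemma pm_residues_eq:
  assumes R: "\<forall>r\<in>R. 0 < r \<and> 2 * r < M"
  shows "pm_residues R M = {n. int n mod M \<in> R \<union> (\<lambda>r. M - r) ` R}"
proof (rule set_eqI)
  fix n
  have "[int n = r] (mod M) \<longleftrightarrow> int n mod M = r" "[int n = - r] (mod M) \<longleftrightarrow> int n mod M = M - r"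
    if "r \<in> R" for r
  proof -
    have r: "r mod M = r" "- r mod M = M - r"
      using bspec[OF R that] by (auto simp: zmod_zminus1_eq_if)
    show "[int n = r] (mod M) \<longleftrightarrow> int n mod M = r" "[int n = - r] (mod M) \<longleftrightarrow> int n mod M = M - r"
      by (simp_all add: unique_euclidean_semiring_class.cong_def r)
  qed
  then have "n \<in> pm_residues R M \<longleftrightarrow> 0 < n \<and> (\<exists>r\<in>R. int n mod M = r \<or> int n mod M = M - r)"
    by (simp add: pm_residues_def cong: bex_cong)
  also have "\<dots> \<longleftrightarrow> 0 < n \<and> int n mod M \<in> R \<union> (\<lambda>r. M - r) ` R"
    by blast
  also have "\<dots> \<longleftrightarrow> n \<in> {n. int n mod M \<in> R \<union> (\<lambda>r. M - r) ` R}"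
    using R by (cases "n = 0") fastforce+
  finally show "n \<in> pm_residues R M \<longleftrightarrow> n \<in> {n. int n mod M \<in> R \<union> (\<lambda>r. M - r) ` R}" .
qed

lemma prod_pm_residues:
  fixes f :: "int \<Rightarrow> 'a :: comm_monoid_mult"
  assumes "finite R" "\<And>r. r \<in> R \<Longrightarrow> 2 * r < M"
  shows "(\<Prod>c\<in>R \<union> (\<lambda>r. M - r) ` R. f c) = (\<Prod>r\<in>R. f r * f (M - r))"
proof -
  have "R \<inter> (\<lambda>r. M - r) ` R = {}"
  proof (rule equals0I)
    fix x assume "x \<in> R \<inter> (\<lambda>r. M - r) ` R"
    then obtain r where "x \<in> R" "r \<in> R" "x = M - r" by auto
    then show False using assms(2)[of x] assms(2)[of r] by linarith
  qed
  then show ?thesis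
    using assms(1) by (simp add: prod.union_disjoint prod.reindex inj_on_def prod.distrib)
qed

theorem partition_gf_pm_residues:
  fixes q :: "'a :: {real_normed_field, banach}"
  assumes R: "\<forall>r\<in>R. 0 < r \<and> 2 * r < M" and M: "M > 0" and q: "norm q < 1" "q \<noteq> 0"
  shows "(\<lambda>n. of_nat (partition_count (pm_residues R M) n) * q ^ n) sums
    inverse (\<Prod>r\<in>R. mod_theta (q powi r) (q powi M))"
proof -
  let ?C = "R \<union> (\<lambda>r. M - r) ` R"
  have "?C \<subseteq> {0<..<M}"
    using R by fastforce
  moreover from this have "finite R"
    using finite_subset by auto
  then have "(\<Prod>c\<in>?C. qpoch_inf (q powi c) (q powi M)) = (\<Prod>r\<in>R. mod_theta (q powi r) (q powi M))"
    using R q by (simp add: prod_pm_residues mod_theta_def power_int_diff)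
  ultimately show ?thesis
    using partition_gf_residue_classes[of ?C M q] M q by (simp only: pm_residues_eq[OF R] simp_thms)
qed

subsection \<open>Comparing coefficients\<close>

lemma powser_coeff_eq_0_if_frequently_0:
  fixes c :: "nat \<Rightarrow> 'a :: {real_normed_field, banach}"
  assumes zero: "\<exists>\<^sub>F x in at 0. (\<lambda>n. c n * x ^ n) sums 0"
  shows "c m = 0"
proof (rule ccontr)
  assume "c m \<noteq> 0"
  \<comment> \<open>Shifting the coefficients makes the series vanish at 0, as \<open>powser_0_nonzero\<close> requires.\<close>
  define b where "b = (\<lambda>n. case n of 0 \<Rightarrow> 0 | Suc k \<Rightarrow> c k)"
  have b: "(\<lambda>n. b n * x ^ n) sums 0" if "(\<lambda>n. c n * x ^ n) sums 0" for x
  proof -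
    have "(\<lambda>n. b (Suc n) * x ^ Suc n) sums 0"
      using sums_mult[OF that, of x] by (simp add: b_def mult_ac)
    then show ?thesis
      by (subst (asm) sums_Suc_iff) (simp add: b_def)
  qed
  obtain x where x: "x \<noteq> 0" "(\<lambda>n. c n * x ^ n) sums 0"
    using frequently_ex[OF frequently_eventually_conj[OF zero, of "\<lambda>x. x \<noteq> 0"]]
    by (auto simp: eventually_at_filter)
  let ?f = "\<lambda>z. \<Sum>n. b n * z ^ n"
  have "(\<lambda>n. b n * (z - 0) ^ n) sums ?f z" if "norm (z - 0) < norm x" for z
    using powser_inside[OF sums_summable[OF b[OF x(2)]], of z] that by (simp add: summable_sums)
  moreover have "?f 0 = 0"
    by (simp add: b_def)
  moreover have "b (Suc m) \<noteq> 0"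
    using \<open>c m \<noteq> 0\<close> by (simp add: b_def)
  ultimately obtain s where s: "0 < s" "\<And>z. z \<in> cball 0 s - {0} \<Longrightarrow> ?f z \<noteq> 0"
    using powser_0_nonzero[of "norm x" 0 b ?f "Suc m"] x(1) by (auto simp del: powser_zero)
  then have "\<forall>\<^sub>F z in at 0. ?f z \<noteq> 0"
    unfolding eventually_at by (intro exI[of _ s]) (auto simp: dist_norm)
  moreover have "\<exists>\<^sub>F z in at 0. ?f z = 0"
    using zero by (rule frequently_elim1) (use b in \<open>auto simp: sums_iff\<close>)
  ultimately show False
    by (simp add: frequently_def)
qed

lemma sums_power_shift:
  fixes q :: "'a :: real_normed_field"
  assumes "(\<lambda>n. a n * q ^ n) sums A"
  shows "(\<lambda>n. (if k \<le> n then a (n - k) else 0) * q ^ n) sums (q ^ k * A)"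
proof -
  have "(\<lambda>n. (if k \<le> n + k then a (n + k - k) else 0) * q ^ (n + k)) sums (q ^ k * A)"
    using sums_mult[OF assms, of "q ^ k"] by (simp add: power_add mult_ac)
  then show ?thesis
    by (subst (asm) sums_iff_shift) simp
qed

lemma shifted_coefficients:
  fixes a b :: "nat \<Rightarrow> nat" and F G :: "real \<Rightarrow> real"
  assumes a: "\<And>q. 0 < q \<Longrightarrow> q < 1 \<Longrightarrow> (\<lambda>n. real (a n) * q ^ n) sums F q"
    and b: "\<And>q. 0 < q \<Longrightarrow> q < 1 \<Longrightarrow> (\<lambda>n. real (b n) * q ^ n) sums G q"
    and eq: "\<And>q. 0 < q \<Longrightarrow> q < 1 \<Longrightarrow> F q = q ^ l + q ^ k * G q"
  shows "a n = (if n = l then 1 else 0) + (if k \<le> n then b (n - k) else 0)"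
proof -
  let ?c = "\<lambda>n. real (a n) - ((if n = l then 1 else 0) + (if k \<le> n then real (b (n - k)) else 0))"
  have "(\<lambda>n. ?c n * q ^ n) sums 0" if q: "0 < q" "q < 1" for q
  proof -
    have "(\<lambda>n. (if n = l then 1 else 0) * q ^ n) sums q ^ l"
      using sums_single[of l "\<lambda>n. q ^ n"] by (simp add: if_distrib[of "\<lambda>x. x * _"] cong: if_cong)
    from sums_diff[OF a[OF q] sums_add[OF this sums_power_shift[OF b[OF q], of k]]] show ?thesis
      unfolding eq[OF q] by (simp add: algebra_simps)
  qed
  then have "\<forall>\<^sub>F q in at_right 0. (\<lambda>n. ?c n * q ^ n) sums 0"
    unfolding eventually_at_right_field by (intro exI[of _ 1]) auto
  then have "\<exists>\<^sub>F q in at 0. (\<lambda>n. ?c n * q ^ n) sums 0"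
    unfolding frequently_def eventually_at_split
    using eventually_happens[OF eventually_conj] by fastforce
  from powser_coeff_eq_0_if_frequently_0[OF this, of n] have
    "real (a n) = real ((if n = l then 1 else 0) + (if k \<le> n then b (n - k) else 0))"
    by simp
  then show ?thesis
    by (simp only: of_nat_eq_iff)
qed

subsection \<open>Generalized Dedekind eta functions\<close>

text \<open>
  The weight is \<open>N/2\<close> times the second Bernoulli polynomial at \<open>k/N\<close>. For \<open>\<alpha> = 1\<close> it makes the theta
  function odd in \<open>k\<close> and antiperiodic under \<open>N\<close>; the case \<open>\<alpha> = - 1\<close> supplies the negative arguments
  of the Weierstrass relation of modulus 30.
\<close>

definition eta_weight :: "real \<Rightarrow> real \<Rightarrow> real" where
  "eta_weight N k = k\<^sup>2 / (2 * N) - k / 2 + N / 12"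

definition gen_eta :: "real \<Rightarrow> real \<Rightarrow> real \<Rightarrow> real \<Rightarrow> real" where
  "gen_eta N q \<alpha> k = q powr eta_weight N k * mod_theta (\<alpha> * q powr k) (q powr N)"

lemma gen_eta_reflect:
  assumes "0 < q" "N > 0"
  shows "gen_eta N q 1 (N - k) = gen_eta N q 1 k"
proof -
  have "eta_weight N (N - k) = eta_weight N k"
    using assms by (simp add: eta_weight_def field_simps power2_eq_square)
  then show ?thesis
    using assms mod_theta_reflect[of "q powr k" "q powr N"] by (simp add: gen_eta_def powr_diff)
qed

lemma gen_eta_minus:
  assumes "0 < q" "q < 1" "N > 0"
  shows "gen_eta N q 1 (- k) = - gen_eta N q 1 k"
proof -
  have "eta_weight N (- k) = eta_weight N k + k"
    by (simp add: eta_weight_def field_simps)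
  then show ?thesis
    using assms mod_theta_inverse[of "q powr N" "q powr k"] powr01_less_one[of q N]
    by (simp add: gen_eta_def powr_add powr_minus)
qed

lemma gen_eta_add_modulus:
  assumes "0 < q" "q < 1" "N > 0"
  shows "gen_eta N q 1 (k + N) = - gen_eta N q 1 k"
  using gen_eta_reflect[of q N "- k"] gen_eta_minus[of q N k] assms by (simp add: add.commute)

lemma
  assumes "0 < q" "q < 1" "N > 0"
  shows gen_eta_reduce_half: "N / 2 < k \<Longrightarrow> k \<le> N \<Longrightarrow> gen_eta N q 1 k = gen_eta N q 1 (N - k)"
    and gen_eta_reduce: "N < k \<Longrightarrow> gen_eta N q 1 k = - gen_eta N q 1 (k - N)"
  using gen_eta_reflect[of q N k] gen_eta_add_modulus[of q N "k - N"] assms by simp_all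

lemmas gen_eta_reductions = gen_eta_minus gen_eta_reduce_half gen_eta_reduce

lemma gen_eta_periodic:
  assumes "0 < q" "q < 1" "N > 0"
  shows "gen_eta N q 1 (k + 2 * N * of_int m) = gen_eta N q 1 k"
proof -
  have shift: "gen_eta N q 1 (x + 2 * N) = gen_eta N q 1 x" for x
    using gen_eta_add_modulus[OF assms, of x] gen_eta_add_modulus[OF assms, of "x + N"]
    by (simp add: algebra_simps)
  show ?thesis
  proof (induction m rule: int_induct[where k = 0])
    case (step1 m)
    then show ?case
      using shift[of "k + 2 * N * of_int m"] by (simp add: algebra_simps)
  next
    case (step2 m)
    then show ?case
      using shift[of "k + 2 * N * of_int (m - 1)"] by (simp add: algebra_simps)
  qed simp
qed

lemma gen_eta_nonzero:
  assumes q: "0 < q" "q < 1" and "N > 0" and k: "\<And>m :: int. k \<noteq> N * of_int m"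
  shows "gen_eta N q 1 k \<noteq> 0"
proof -
  have powr_neq_1: "q powr x \<noteq> 1" if "x \<noteq> 0" for x
    using q that by simp
  have "mod_theta (q powr k) (q powr N) \<noteq> 0"
  proof (rule mod_theta_nonzero)
    show "norm (q powr N) < 1"
      using assms powr01_less_one[of q N] by simp
    show "q powr k * (q powr N) ^ i \<noteq> 1" for i
      using powr_neq_1[of "k + N * i"] k[of "- int i"] q
      by (simp add: powr_add powr_powr flip: powr_realpow)
    show "q powr N / q powr k * (q powr N) ^ i \<noteq> 1" for i
      using powr_neq_1[of "N - k + N * i"] k[of "int i + 1"] q
      by (simp add: powr_add powr_diff powr_powr algebra_simps flip: powr_realpow)
  qed
  then show ?thesis
    using q by (simp add: gen_eta_def)
qed

lemma gen_eta_bisect: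
  assumes "0 < q" "q < 1" "N > 0" "\<alpha> \<noteq> 0"
  shows "gen_eta N q \<alpha> k = gen_eta (2 * N) q \<alpha> k * gen_eta (2 * N) q (1 / \<alpha>) (N - k)"
proof -
  have "eta_weight N k = eta_weight (2 * N) k + eta_weight (2 * N) (N - k)"
    using assms by (simp add: eta_weight_def field_simps power2_eq_square)
  moreover have "(q powr N)\<^sup>2 = q powr (2 * N)"
    using assms by (simp add: powr_powr mult.commute flip: powr_realpow)
  ultimately show ?thesis
    using assms mod_theta_bisect[of "q powr N" "\<alpha> * q powr k"] powr01_less_one[of q N]
    by (simp add: gen_eta_def powr_add powr_diff mult_ac)
qed

lemma gen_eta_mult_uminus:
  assumes "0 < q" "q < 1" "N > 0"
  shows "gen_eta N q \<alpha> k * gen_eta N q (- \<alpha>) k = gen_eta (2 * N) q (\<alpha>\<^sup>2) (2 * k)"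
proof -
  have "eta_weight (2 * N) (2 * k) = eta_weight N k + eta_weight N k"
    using assms by (simp add: eta_weight_def field_simps power2_eq_square)
  then have "q powr eta_weight (2 * N) (2 * k) = q powr eta_weight N k * q powr eta_weight N k"
    by (simp only: powr_add)
  moreover have "(q powr x)\<^sup>2 = q powr (2 * x)" for x
    using assms by (simp add: powr_powr mult.commute flip: powr_realpow)
  ultimately show ?thesis
    using assms mod_theta_mult_minus[of "q powr N" "\<alpha> * q powr k"] powr01_less_one[of q N]
    by (simp add: gen_eta_def powr_add power_mult_distrib mult_ac)
qed

lemma gen_eta_pair:
  assumes "0 < q" "N > 0"
  shows "gen_eta N q (\<alpha> * \<beta>) (a + b) * gen_eta N q (\<alpha> / \<beta>) (a - b) =
    q powr (a\<^sup>2 / N + N / 12) * q powr (b\<^sup>2 / N + N / 12) / q powr a *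
    (mod_theta (\<alpha> * q powr a * (\<beta> * q powr b)) (q powr N) *
     mod_theta (\<alpha> * q powr a / (\<beta> * q powr b)) (q powr N))"
    (is "_ = ?W * ?P")
proof -
  have "eta_weight N (a + b) + eta_weight N (a - b) = (a\<^sup>2 / N + N / 12) + (b\<^sup>2 / N + N / 12) - a"
    using assms by (simp add: eta_weight_def field_simps power2_eq_square)
  then have weights: "q powr eta_weight N (a + b) * q powr eta_weight N (a - b) = ?W"
    by (simp flip: powr_add powr_diff)
  have "gen_eta N q (\<alpha> * \<beta>) (a + b) * gen_eta N q (\<alpha> / \<beta>) (a - b) =
      (q powr eta_weight N (a + b) * q powr eta_weight N (a - b)) * ?P"
    by (simp add: gen_eta_def powr_add powr_diff mult_ac)
  then show ?thesis
    unfolding weights .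
qed

text \<open>
  The weights absorb the factors \<open>y\<close> and \<open>z\<close> of the addition formula for \<^const>\<open>mod_theta\<close>.
\<close>

lemma gen_eta_weierstrass:
  assumes q: "0 < q" "q < 1" and N: "N > 0" and nz: "\<alpha> \<noteq> 0" "\<beta> \<noteq> 0" "\<gamma> \<noteq> 0" "\<delta> \<noteq> 0"
  defines "\<eta> \<equiv> gen_eta N q"
  shows "\<beta> * (\<eta> (\<alpha> * \<beta>) (a + b) * \<eta> (\<alpha> / \<beta>) (a - b) * \<eta> (\<gamma> * \<delta>) (c + d) * \<eta> (\<gamma> / \<delta>) (c - d)) =
    \<gamma> * (\<eta> (\<alpha> * \<gamma>) (a + c) * \<eta> (\<alpha> / \<gamma>) (a - c) * \<eta> (\<beta> * \<delta>) (b + d) * \<eta> (\<beta> / \<delta>) (b - d) -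
      \<eta> (\<alpha> * \<delta>) (a + d) * \<eta> (\<alpha> / \<delta>) (a - d) * \<eta> (\<beta> * \<gamma>) (b + c) * \<eta> (\<beta> / \<gamma>) (b - c))"
proof -
  define g where "g k = q powr (k\<^sup>2 / N + N / 12)" for k
  define P where "P \<mu> k \<nu> l = mod_theta (\<mu> * q powr k * (\<nu> * q powr l)) (q powr N) *
    mod_theta (\<mu> * q powr k / (\<nu> * q powr l)) (q powr N)" for \<mu> k \<nu> l
  have pair: "\<eta> (\<mu> * \<nu>) (k + l) * \<eta> (\<mu> / \<nu>) (k - l) = g k * g l / q powr k * P \<mu> k \<nu> l" for \<mu> k \<nu> l
    unfolding \<eta>_def g_def P_def using q(1) N by (rule gen_eta_pair)
  define G where "G = g a * g b * g c * g d / (q powr a * q powr b * q powr c)"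
  have addition: "\<beta> * q powr b * (P \<alpha> a \<beta> b * P \<gamma> c \<delta> d) =
      \<gamma> * q powr c * (P \<alpha> a \<gamma> c * P \<beta> b \<delta> d - P \<alpha> a \<delta> d * P \<beta> b \<gamma> c)"
    using weierstrass_addition[of "q powr N" "\<alpha> * q powr a" "\<beta> * q powr b" "\<gamma> * q powr c" "\<delta> * q powr d"]
      q N nz powr01_less_one[OF q, of N] by (simp add: P_def mult.assoc)
  have "\<beta> * (g a * g b / q powr a * P \<alpha> a \<beta> b * (g c * g d / q powr c * P \<gamma> c \<delta> d)) =
      G * (\<beta> * q powr b * (P \<alpha> a \<beta> b * P \<gamma> c \<delta> d))"
    using q by (simp add: G_def field_simps)
  also have "\<dots> = \<gamma> * (g a * g c / q powr a * P \<alpha> a \<gamma> c * (g b * g d / q powr b * P \<beta> b \<delta> d) -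
        g a * g d / q powr a * P \<alpha> a \<delta> d * (g b * g c / q powr b * P \<beta> b \<gamma> c))"
    unfolding addition using q by (simp add: G_def field_simps)
  finally show ?thesis
    by (simp only: mult.assoc flip: pair)
qed

subsection \<open>Theta functions of modulus 60\<close>

lemma inverse_difference_by_elimination:
  fixes X Y Z v p r \<alpha> \<beta> \<gamma> \<delta> :: "'a :: field"
  assumes X: "X * Z = r * \<alpha> + p * \<beta>" and Y: "Y * Z = r * \<gamma> + p * \<delta>"
    and mixed: "r / (p * (\<beta> * \<delta>)) - p / (r * (\<alpha> * \<gamma>)) = X * Y * Z * v"
    and nz: "X \<noteq> 0" "Y \<noteq> 0" "Z \<noteq> 0" "v \<noteq> 0" "p \<noteq> 0" "r \<noteq> 0" "\<alpha> \<noteq> 0" "\<beta> \<noteq> 0" "\<gamma> \<noteq> 0" "\<delta> \<noteq> 0"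
  shows "inverse (v * \<alpha> * \<delta> * (Y * p * \<beta>)) = 1 + inverse (v * \<alpha> * \<delta> * (X * r * \<gamma>))"
proof -
  have "Z * (X * r * \<gamma> - Y * p * \<beta>) = (X * Z) * (r * \<gamma>) - (Y * Z) * (p * \<beta>)"
    by algebra
  also have "\<dots> = r\<^sup>2 * (\<alpha> * \<gamma>) - p\<^sup>2 * (\<beta> * \<delta>)"
    unfolding X Y by algebra
  also have "\<dots> = (r / (p * (\<beta> * \<delta>)) - p / (r * (\<alpha> * \<gamma>))) * (p * r * (\<alpha> * \<beta> * \<gamma> * \<delta>))"
    using nz by (simp add: field_simps power2_eq_square)
  also have "\<dots> = Z * (X * Y * v * p * r * (\<alpha> * \<beta> * \<gamma> * \<delta>))"
    unfolding mixed by algebra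
  finally have "X * r * \<gamma> - Y * p * \<beta> = X * Y * v * p * r * (\<alpha> * \<beta> * \<gamma> * \<delta>)"
    using nz by simp
  then show ?thesis
    using nz by (simp add: divide_simps) algebra
qed

text \<open>
  Multiplying all residues by a unit \<open>u\<close> modulo 60 does not affect the relations below: \<open>u = 1\<close> leads to
  parts (i) and (iv) of the theorem, and \<open>u = - 7\<close> to parts (ii) and (iii). The sign is chosen to make \<open>u\<close>
  congruent to 1 modulo 4, which keeps the bisection formula free of signs.
\<close>

locale theta60 =
  fixes q :: real and u :: int
  assumes q: "0 < q" "q < 1" and u: "u mod 4 = 1" "coprime u 60"
begin

definition \<sigma> :: "int \<Rightarrow> real" where "\<sigma> k = gen_eta 60 q 1 (of_int (u * k))"

lemma sigma_reflect: "\<sigma> (60 - k) = \<sigma> k"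
proof -
  obtain m where m: "u = 4 * m + 1"
    using u(1) mult_div_mod_eq[of 4 u] by metis
  have "\<sigma> (60 - k) = gen_eta 60 q 1 (60 - of_int (u * k) + 2 * 60 * of_int (2 * m))"
    unfolding \<sigma>_def by (simp add: m algebra_simps)
  then show ?thesis
    using q gen_eta_periodic[of q 60 _ "2 * m"] by (simp add: \<sigma>_def gen_eta_reflect)
qed

lemma sigma_nonzero:
  assumes "\<not> 60 dvd k"
  shows "\<sigma> k \<noteq> 0"
  unfolding \<sigma>_def
proof (rule gen_eta_nonzero)
  show "real_of_int (u * k) \<noteq> 60 * real_of_int m" for m
  proof
    assume "real_of_int (u * k) = 60 * real_of_int m"
    then have "real_of_int (u * k) = real_of_int (60 * m)"
      by simp
    then have "60 dvd u * k"
      by (simp only: of_int_eq_iff dvd_triv_left)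
    then show False
      using assms u by (simp add: coprime_dvd_mult_right_iff coprime_commute)
  qed
qed (use q in simp_all)

lemma sigma_weierstrass:
  "\<sigma> (a + b) * \<sigma> (a - b) * \<sigma> (c + d) * \<sigma> (c - d) =
   \<sigma> (a + c) * \<sigma> (a - c) * \<sigma> (b + d) * \<sigma> (b - d) - \<sigma> (a + d) * \<sigma> (a - d) * \<sigma> (b + c) * \<sigma> (b - c)"
  using gen_eta_weierstrass[OF q, of 60 1 1 1 1
      "of_int (u * a)" "of_int (u * b)" "of_int (u * c)" "of_int (u * d)"]
  by (simp add: \<sigma>_def algebra_simps)

definition \<rho> :: "int \<Rightarrow> real" where "\<rho> k = gen_eta 30 q 1 (of_int (u * k))"

definition \<tau> :: "int \<Rightarrow> real" where "\<tau> k = gen_eta 30 q (- 1) (of_int (u * k))"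

lemma rho_eq: "\<rho> k = \<sigma> k * \<sigma> (30 - k)"
proof -
  obtain m where m: "u = 4 * m + 1"
    using u(1) mult_div_mod_eq[of 4 u] by metis
  have "\<sigma> (30 - k) = gen_eta 60 q 1 (30 - of_int (u * k) + 2 * 60 * of_int m)"
    unfolding \<sigma>_def by (simp add: m algebra_simps)
  then show ?thesis
    using q gen_eta_bisect[of q 30 1 "of_int (u * k)"] gen_eta_periodic[of q 60 _ m]
    by (simp add: \<rho>_def \<sigma>_def)
qed

lemma tau_eq:
  assumes "\<not> 30 dvd k"
  shows "\<tau> k = \<sigma> (2 * k) / (\<sigma> k * \<sigma> (30 - k))"
proof -
  have "\<not> 60 dvd k" "\<not> 60 dvd 30 - k"
    using assms by presburger+
  then have "\<sigma> k * \<sigma> (30 - k) \<noteq> 0"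
    by (simp add: sigma_nonzero)
  moreover have "\<rho> k * \<tau> k = \<sigma> (2 * k)"
    using q gen_eta_mult_uminus[of q 30 1 "of_int (u * k)"] by (simp add: \<rho>_def \<tau>_def \<sigma>_def mult_ac)
  ultimately show ?thesis
    unfolding rho_eq by (simp add: field_simps)
qed

lemma rho_tau_weierstrass:
  "\<rho> (a + c) * \<rho> (a - c) * \<rho> (b + d) * \<rho> (b - d) =
   \<tau> (a + d) * \<tau> (a - d) * \<tau> (b + c) * \<tau> (b - c) - \<tau> (a + b) * \<tau> (a - b) * \<tau> (c + d) * \<tau> (c - d)"
  using gen_eta_weierstrass[OF q, of 30 "- 1" 1 "- 1" 1
      "of_int (u * a)" "of_int (u * b)" "of_int (u * c)" "of_int (u * d)"]
  by (simp add: \<rho>_def \<tau>_def distrib_left right_diff_distrib)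

lemma sigma_reduce: "30 < k \<Longrightarrow> \<sigma> k = \<sigma> (60 - k)"
  by (simp add: sigma_reflect)

lemma sigma_9_relation:
  "\<sigma> 9 * (\<sigma> 15 * \<sigma> 18 * \<sigma> 20) = \<sigma> 26 * \<sigma> 28 * (\<sigma> 1 * \<sigma> 23) + \<sigma> 8 * \<sigma> 14 * (\<sigma> 17 * \<sigma> 19)"
  using sigma_weierstrass[of 27 19 18 1] by (simp add: sigma_reduce algebra_simps)

lemma sigma_21_relation:
  "\<sigma> 21 * (\<sigma> 15 * \<sigma> 18 * \<sigma> 20) = \<sigma> 26 * \<sigma> 28 * (\<sigma> 7 * \<sigma> 29) + \<sigma> 8 * \<sigma> 14 * (\<sigma> 11 * \<sigma> 13)"
  using sigma_weierstrass[of 27 19 12 1] by (simp add: sigma_reduce algebra_simps)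

lemma sigma_mixed_relation:
  "\<sigma> 26 * \<sigma> 28 / (\<sigma> 8 * \<sigma> 14 * ((\<sigma> 17 * \<sigma> 19) * (\<sigma> 11 * \<sigma> 13))) -
   \<sigma> 8 * \<sigma> 14 / (\<sigma> 26 * \<sigma> 28 * ((\<sigma> 1 * \<sigma> 23) * (\<sigma> 7 * \<sigma> 29))) =
   \<sigma> 9 * \<sigma> 21 * (\<sigma> 15 * \<sigma> 18 * \<sigma> 20) * (\<sigma> 10 * \<sigma> 12 * \<sigma> 15)"
  using rho_tau_weierstrass[of 12 3 11 1]
  by (simp add: rho_eq tau_eq sigma_reduce sigma_nonzero mult_ac)

lemma inverse_sigma_products_i:
  "inverse (\<Prod>r\<in>{1, 8, 10, 11, 12, 13, 14, 15, 17, 19, 21, 23}. \<sigma> r) =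
   1 + inverse (\<Prod>r\<in>{1, 7, 9, 10, 11, 12, 13, 15, 23, 26, 28, 29}. \<sigma> r)"
  using inverse_difference_by_elimination[OF sigma_9_relation sigma_21_relation sigma_mixed_relation]
  by (simp add: sigma_nonzero mult_ac)

lemma inverse_sigma_products_iv:
  "inverse (\<Prod>r\<in>{7, 8, 9, 10, 11, 12, 13, 14, 15, 17, 19, 29}. \<sigma> r) =
   1 + inverse (\<Prod>r\<in>{1, 7, 10, 12, 15, 17, 19, 21, 23, 26, 28, 29}. \<sigma> r)"
  using inverse_difference_by_elimination[OF sigma_21_relation sigma_9_relation] sigma_mixed_relation
  by (simp add: sigma_nonzero mult_ac)

end

lemma
  assumes "0 < q" "q < 1"
  shows theta60_1: "theta60 q 1" and theta60_minus_7: "theta60 q (- 7)"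
  using assms by (unfold_locales; simp add: coprime_iff_gcd_eq_1 gcd_non_0_int)+

subsection \<open>The partition identities\<close>

theorem partition_gf_gen_eta:
  assumes R: "\<forall>r\<in>R. 0 < r \<and> 2 * r < M" and M: "M > 0" and q: "0 < q" "q < 1"
  shows "(\<lambda>n. real (partition_count (pm_residues R M) n) * q ^ n) sums
    (q powr (\<Sum>r\<in>R. eta_weight (of_int M) (of_int r)) * inverse (\<Prod>r\<in>R. gen_eta (of_int M) q 1 (of_int r)))"
proof -
  have "(\<Prod>r\<in>R. gen_eta (of_int M) q 1 (of_int r)) =
      q powr (\<Sum>r\<in>R. eta_weight (of_int M) (of_int r)) * (\<Prod>r\<in>R. mod_theta (q powi r) (q powi M))"
    using q by (simp add: gen_eta_def prod.distrib powr_sum powr_real_of_int')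
  then show ?thesis
    using partition_gf_pm_residues[OF R M, of q] q by (simp flip: mult.assoc)
qed

lemma partition_count_shift:
  assumes R: "\<forall>r\<in>R. 0 < r \<and> 2 * r < M" and R': "\<forall>r\<in>R'. 0 < r \<and> 2 * r < M" and M: "M > 0"
    and eq: "\<And>q. 0 < q \<Longrightarrow> q < 1 \<Longrightarrow> inverse (\<Prod>r\<in>R. gen_eta (of_int M) q 1 (of_int r)) =
      1 + inverse (\<Prod>r\<in>R'. gen_eta (of_int M) q 1 (of_int r))"
    and weights: "(\<Sum>r\<in>R. eta_weight (of_int M) (of_int r)) = real l"
      "(\<Sum>r\<in>R'. eta_weight (of_int M) (of_int r)) = real l - real k"
    and n: "n \<noteq> l" "k \<le> n"
  shows "partition_count (pm_residues R M) n = partition_count (pm_residues R' M) (n - k)"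
proof -
  have "partition_count (pm_residues R M) n =
      (if n = l then 1 else 0) + (if k \<le> n then partition_count (pm_residues R' M) (n - k) else 0)"
  proof (rule shifted_coefficients)
    fix q :: real assume q: "0 < q" "q < 1"
    let ?\<eta> = "\<lambda>r. gen_eta (of_int M) q 1 (of_int r)"
    show "(\<lambda>n. real (partition_count (pm_residues R M) n) * q ^ n) sums (q powr real l * inverse (\<Prod>r\<in>R. ?\<eta> r))"
      using partition_gf_gen_eta[OF R M q] by (simp only: weights)
    show "(\<lambda>n. real (partition_count (pm_residues R' M) n) * q ^ n) sums
        (q powr (real l - real k) * inverse (\<Prod>r\<in>R'. ?\<eta> r))"
      using partition_gf_gen_eta[OF R' M q] by (simp only: weights)
    show "q powr real l * inverse (\<Prod>r\<in>R. ?\<eta> r) =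
        q ^ l + q ^ k * (q powr (real l - real k) * inverse (\<Prod>r\<in>R'. ?\<eta> r))"
      unfolding eq[OF q] using q by (simp add: powr_diff powr_realpow distrib_left)
  qed
  with n show ?thesis
    by simp
qed

lemma partition_count_shift_by_1:
  assumes "n \<ge> 1"
  shows "partition_count (pm_residues {1, 8, 10, 11, 12, 13, 14, 15, 17, 19, 21, 23} 60) n =
    partition_count (pm_residues {1, 7, 9, 10, 11, 12, 13, 15, 23, 26, 28, 29} 60) (n - 1)"
    (is "partition_count (pm_residues ?S 60) n = partition_count (pm_residues ?T 60) _")
proof (rule partition_count_shift[where l = 0 and k = 1])
  fix q :: real assume q: "0 < q" "q < 1"
  note theta60 = theta60_1[OF q]
  show "inverse (\<Prod>r\<in>?S. gen_eta (of_int 60) q 1 (of_int r)) =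
      1 + inverse (\<Prod>r\<in>?T. gen_eta (of_int 60) q 1 (of_int r))"
    using theta60.inverse_sigma_products_i[OF theta60] by (simp add: theta60.\<sigma>_def[OF theta60])
qed (use assms in \<open>auto simp: eta_weight_def\<close>)

lemma partition_count_shift_by_7:
  assumes "n \<ge> 7"
  shows "partition_count (pm_residues {7, 8, 9, 10, 11, 12, 13, 14, 15, 17, 19, 29} 60) n =
    partition_count (pm_residues {1, 7, 10, 12, 15, 17, 19, 21, 23, 26, 28, 29} 60) (n - 7)"
    (is "partition_count (pm_residues ?S 60) n = partition_count (pm_residues ?T 60) _")
proof (rule partition_count_shift[where l = 0 and k = 7])
  fix q :: real assume q: "0 < q" "q < 1"
  note theta60 = theta60_1[OF q]
  show "inverse (\<Prod>r\<in>?S. gen_eta (of_int 60) q 1 (of_int r)) =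
      1 + inverse (\<Prod>r\<in>?T. gen_eta (of_int 60) q 1 (of_int r))"
    using theta60.inverse_sigma_products_iv[OF theta60] by (simp add: theta60.\<sigma>_def[OF theta60])
qed (use assms in \<open>auto simp: eta_weight_def\<close>)

lemma partition_count_shift_by_2:
  assumes "n \<ge> 2"
  shows "partition_count (pm_residues {2, 3, 7, 10, 11, 15, 16, 17, 19, 23, 24, 29} 60) n =
    partition_count (pm_residues {1, 4, 7, 10, 13, 15, 17, 19, 22, 24, 27, 29} 60) (n - 2)"
    (is "partition_count (pm_residues ?S 60) n = partition_count (pm_residues ?T 60) _")
proof (rule partition_count_shift[where l = 0 and k = 2])
  fix q :: real assume q: "0 < q" "q < 1"
  note theta60 = theta60_minus_7[OF q]
  show "inverse (\<Prod>r\<in>?S. gen_eta (of_int 60) q 1 (of_int r)) =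
      1 + inverse (\<Prod>r\<in>?T. gen_eta (of_int 60) q 1 (of_int r))"
    using theta60.inverse_sigma_products_i[OF theta60]
    by (simp add: theta60.\<sigma>_def[OF theta60] gen_eta_reductions q mult_ac)
qed (use assms in \<open>auto simp: eta_weight_def\<close>)

lemma partition_count_shift_by_0:
  assumes "n \<noteq> 2"
  shows "partition_count (pm_residues {1, 2, 7, 10, 11, 13, 15, 16, 19, 23, 24, 27} 60) n =
    partition_count (pm_residues {1, 3, 4, 10, 11, 13, 15, 17, 22, 23, 24, 29} 60) n"
    (is "partition_count (pm_residues ?S 60) n = partition_count (pm_residues ?T 60) _")
proof (rule partition_count_shift[where l = 2 and k = 0, unfolded diff_zero])
  fix q :: real assume q: "0 < q" "q < 1"
  note theta60 = theta60_minus_7[OF q]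
  show "inverse (\<Prod>r\<in>?S. gen_eta (of_int 60) q 1 (of_int r)) =
      1 + inverse (\<Prod>r\<in>?T. gen_eta (of_int 60) q 1 (of_int r))"
    using theta60.inverse_sigma_products_iv[OF theta60]
    by (simp add: theta60.\<sigma>_def[OF theta60] gen_eta_reductions q mult_ac)
qed (use assms in \<open>auto simp: eta_weight_def\<close>)

theorem theorem12p6:
  shows
    "(let S = pm_residues {1, 8, 10, 11, 12, 13, 14, 15, 17, 19, 21, 23} 60;
          T = pm_residues {1, 7, 9, 10, 11, 12, 13, 15, 23, 26, 28, 29} 60
      in \<forall>n\<ge>1. partition_count S n = partition_count T (n - 1)) \<and>
     (let S = pm_residues {2, 3, 7, 10, 11, 15, 16, 17, 19, 23, 24, 29} 60;
          T = pm_residues {1, 4, 7, 10, 13, 15, 17, 19, 22, 24, 27, 29} 60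
      in \<forall>n\<ge>2. partition_count S n = partition_count T (n - 2)) \<and>
     (let S = pm_residues {1, 3, 4, 10, 11, 13, 15, 17, 22, 23, 24, 29} 60;
          T = pm_residues {1, 2, 7, 10, 11, 13, 15, 16, 19, 23, 24, 27} 60
      in \<forall>n. n \<noteq> 2 \<longrightarrow> partition_count S n = partition_count T n) \<and>
     (let S = pm_residues {7, 8, 9, 10, 11, 12, 13, 14, 15, 17, 19, 29} 60;
          T = pm_residues {1, 7, 10, 12, 15, 17, 19, 21, 23, 26, 28, 29} 60
      in \<forall>n\<ge>7. partition_count S n = partition_count T (n - 7))"
  unfolding Let_def
proof (intro conjI allI impI)
  fix n :: nat
  show "partition_count (pm_residues {1, 8, 10, 11, 12, 13, 14, 15, 17, 19, 21, 23} 60) n =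
      partition_count (pm_residues {1, 7, 9, 10, 11, 12, 13, 15, 23, 26, 28, 29} 60) (n - 1)" if "1 \<le> n"
    using that by (rule partition_count_shift_by_1)
  show "partition_count (pm_residues {2, 3, 7, 10, 11, 15, 16, 17, 19, 23, 24, 29} 60) n =
      partition_count (pm_residues {1, 4, 7, 10, 13, 15, 17, 19, 22, 24, 27, 29} 60) (n - 2)" if "2 \<le> n"
    using that by (rule partition_count_shift_by_2)
  show "partition_count (pm_residues {1, 3, 4, 10, 11, 13, 15, 17, 22, 23, 24, 29} 60) n =
      partition_count (pm_residues {1, 2, 7, 10, 11, 13, 15, 16, 19, 23, 24, 27} 60) n" if "n \<noteq> 2"
    using that by (rule partition_count_shift_by_0[symmetric])
  show "partition_count (pm_residues {7, 8, 9, 10, 11, 12, 13, 14, 15, 17, 19, 29} 60) n =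
      partition_count (pm_residues {1, 7, 10, 12, 15, 17, 19, 21, 23, 26, 28, 29} 60) (n - 7)" if "7 \<le> n"
    using that by (rule partition_count_shift_by_7)
qed

end
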